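(* For all real $z>0$ and $\nu\ge 0$, $$I_1(z,\nu)=\int_0^\infty y^{\nu}e^{-y}e^{-zy^{-1/2}}\,dy=\pi^{-1/2}\,G^{3,0}_{0,3}\left(\frac{z^2}{4}\,\Big|\,{}_{0,\frac12,1+\nu}\right).$$
   Context: $I_1(z,\nu)$ denotes the integral $\int_0^\infty y^\nu e^{-y}e^{-zy^{-1/2}}\,dy$. Meijer $G$-function: for integers $0\le n\le p$, $0\le m\le q$, complex numbers $a_1,\dots,a_p$, $b_1,\dots,b_q$ such that no pole of $\Gamma(b_j+s)$ $(j=1,\dots,m)$ coincides with a pole of $\Gamma(1-a_j-s)$ $(j=1,\dots,n)$, and $z\ne 0$, $$G^{m,n}_{p,q}\left(z\,\Big|\,{}^{a_1,\ldots,a_p}_{b_1,\ldots,b_q}\right)=\frac{1}{2\pi i}\int_L\frac{\prod_{j=1}^m\Gamma(b_j+s)\prod_{j=1}^n\Gamma(1-a_j-s)}{\prod_{j=m+1}^q\Gamma(1-b_j-s)\prod_{j=n+1}^p\Gamma(a_j+s)}\,z^{-s}\,ds,$$ where empty products equal $1$, and $L$ is a loop beginning and ending at $-\infty$ and encircling all poles of $\Gamma(b_j+s)$, $j=1,\dots,m$, once in the positive direction, but none of the poles of $\Gamma(1-a_j-s)$, $j=1,\dots,n$. The integral is well-defined for all $z\neq0$ when $q\ge1$ and $p<q$, and it then equals the sum of the residues of the integrand at the poles of $\Gamma(b_j+s)$, $j=1,\dots,m$. When $p=0$ the upper row of parameters is empty, so $$G^{3,0}_{0,3}\left(x\,\Big|\,{}_{b_1,b_2,b_3}\right)=\frac1{2\pi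 i}\int_L\Gamma(b_1+s)\Gamma(b_2+s)\Gamma(b_3+s)\,x^{-s}\,ds.$$ For $x>0$, $x^{-s}=e^{-s\log x}$ with real logarithm. *)

theory Defs
  imports "HOL-Complex_Analysis.Complex_Analysis"
begin

definition I1 :: "real \<Rightarrow> real \<Rightarrow> real" where
  "I1 z \<nu> = (LBINT y:{0<..}. y powr \<nu> * exp (- y) * exp (- z * y powr (- 1 / 2)))"

text \<open>
  A loop beginning and ending at \<open>-\<infinity>\<close> is given by its finite part \<open>g\<close>: the whole loop consists of
  the horizontal ray coming in from \<open>-\<infinity>\<close> to \<open>pathstart g\<close>, the path \<open>g\<close>, and the horizontal ray
  from \<open>pathfinish g\<close> back to \<open>-\<infinity>\<close>. The path below is this loop with the incoming and the outgoing
  ray cut off at real part \<open>-S\<close> and \<open>-T\<close>, respectively.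
\<close>

definition trunc_loop :: "(real \<Rightarrow> complex) \<Rightarrow> real \<Rightarrow> real \<Rightarrow> real \<Rightarrow> complex" where
  "trunc_loop g S T =
     linepath (Complex (- S) (Im (pathstart g))) (pathstart g) +++ g +++
     linepath (pathfinish g) (Complex (- T) (Im (pathfinish g)))"

definition closed_loop :: "(real \<Rightarrow> complex) \<Rightarrow> real \<Rightarrow> real \<Rightarrow> complex" where
  "closed_loop g T = trunc_loop g T T +++
     linepath (Complex (- T) (Im (pathfinish g))) (Complex (- T) (Im (pathstart g)))"

text \<open>
  The loop does not meet \<open>w\<close> and winds \<open>k\<close> times around it in the positive direction.
\<close>

definition loop_index :: "(real \<Rightarrow> complex) \<Rightarrow> complex \<Rightarrow> complex \<Rightarrow> bool" where
  "loop_index g w k \<longleftrightarrow>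
     (\<forall>\<^sub>F T in at_top. w \<notin> path_image (closed_loop g T) \<and> winding_number (closed_loop g T) w = k)"

text \<open>
  In the Meijer function the parameters \<open>a\<^sub>1, \<dots>, a\<^sub>p\<close> and \<open>b\<^sub>1, \<dots>, b\<^sub>q\<close> are the entries of the lists
  \<open>A\<close> and \<open>B\<close>. The power \<open>z\<^sup>-\<^sup>s\<close> is taken with the principal branch of the logarithm. Division by a
  product of Gamma values agrees with the usual convention that \<open>1 / \<Gamma>\<close> vanishes at the poles
  of \<open>\<Gamma>\<close>, since \<open>Gamma\<close> is \<open>0\<close> there and \<open>x / 0 = 0\<close>.
\<close>

definition meijer_integrand ::
  "nat \<Rightarrow> nat \<Rightarrow> complex list \<Rightarrow> complex list \<Rightarrow> complex \<Rightarrow> complex \<Rightarrow> complex" where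
  "meijer_integrand m n A B z s =
     ((\<Prod>b\<leftarrow>take m B. Gamma (b + s)) * (\<Prod>a\<leftarrow>take n A. Gamma (1 - a - s))) /
     ((\<Prod>b\<leftarrow>drop m B. Gamma (1 - b - s)) * (\<Prod>a\<leftarrow>drop n A. Gamma (a + s))) * z powr (- s)"

definition meijer_loop ::
  "nat \<Rightarrow> nat \<Rightarrow> complex list \<Rightarrow> complex list \<Rightarrow> (real \<Rightarrow> complex) \<Rightarrow> bool" where
  "meijer_loop m n A B g \<longleftrightarrow> valid_path g \<and>
     (\<forall>b\<in>set (take m B). \<forall>w. is_pole (\<lambda>s. Gamma (b + s)) w \<longrightarrow> loop_index g w 1) \<and>
     (\<forall>a\<in>set (take n A). \<forall>w. is_pole (\<lambda>s. Gamma (1 - a - s)) w \<longrightarrow> loop_index g w 0)"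

text \<open>
  The value \<open>v\<close> is the common value of the (improper) integrals over all admissible loops. If a pole
  of some \<open>\<Gamma>(b\<^sub>j + s)\<close>, \<open>j \<le> m\<close>, is also a pole of some \<open>\<Gamma>(1 - a\<^sub>j - s)\<close>, \<open>j \<le> n\<close>, then there is no
  admissible loop and the function has no value.
\<close>

definition has_meijer_G ::
  "nat \<Rightarrow> nat \<Rightarrow> complex list \<Rightarrow> complex list \<Rightarrow> complex \<Rightarrow> complex \<Rightarrow> bool" where
  "has_meijer_G m n A B z v \<longleftrightarrow> m \<le> length B \<and> n \<le> length A \<and> z \<noteq> 0 \<and>
     (\<exists>g. meijer_loop m n A B g) \<and>
     (\<forall>g. meijer_loop m n A B g \<longrightarrow>
        ((\<lambda>(S, T). 1 / (2 * of_real pi * \<i>) *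
            contour_integral (trunc_loop g S T) (meijer_integrand m n A B z)) \<longlongrightarrow> v)
          (at_top \<times>\<^sub>F at_top))"

definition meijer_G ::
  "nat \<Rightarrow> nat \<Rightarrow> complex list \<Rightarrow> complex list \<Rightarrow> complex \<Rightarrow> complex" where
  "meijer_G m n A B z = (THE v. has_meijer_G m n A B z v)"

end

theory Submission
  imports Defs "HOL-Real_Asymp.Real_Asymp"
begin

text \<open>
  By the duplication formula the integrand is \<open>2 \<surd>\<pi> \<Gamma>(2s) \<Gamma>(1 + \<nu> + s) z\<^sup>-\<^sup>2\<^sup>s\<close>. On a vertical line
  \<open>\<Gamma>(1 + \<nu> + s)\<close> may be replaced by Euler's integral, and exchanging the integrals leaves the
  Cahen-Mellin integral of \<open>\<Gamma>(u) w\<^sup>-\<^sup>u\<close>, whose value \<open>2 \<pi> e\<^sup>-\<^sup>w\<close> is the sum of its residues.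

  To pass from the line to a loop, both are compared with the sum of the residues to the right of
  \<open>Re s = -(t\<^sub>0 + n)\<close>, where \<open>t\<^sub>0\<close> is chosen such that these lines keep a fixed distance from all
  poles. The edges that have to be discarded vanish in the limit because away from its poles
  \<open>\<Gamma>(s) (1 + |Im s|)\<^sup>2\<close> is \<open>O(M powr Re s)\<close> in each left half-plane, for every \<open>M\<close>. This bound needs no
  more than \<open>\<Gamma>(s + 1) = s \<Gamma>(s)\<close>.
\<close>

subsection \<open>Decay of the Gamma function to the left\<close>

text \<open>In Euler's integral the modulus of \<open>t powr (s - 1)\<close> depends on
  \<open>Re s\<close> alone, so the triangle inequality for integrals suffices.\<close>

lemma cmod_Gamma_le:
  assumes "Re s > 0"
  shows "cmod (Gamma s) \<le> Gamma (Re s)"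
proof -
  have c: "((\<lambda>t. of_real t powr (s - 1) / of_real (exp t)) has_integral Gamma s) {0..}"
    by (rule Gamma_integral_complex[OF assms])
  have r: "((\<lambda>t. t powr (Re s - 1) / exp t) has_integral Gamma (Re s)) {0..}"
    by (rule Gamma_integral_real[OF assms])
  have "cmod (integral {0..} (\<lambda>t. of_real t powr (s - 1) / of_real (exp t)))
      \<le> integral {0..} (\<lambda>t. t powr (Re s - 1) / exp t)"
  proof (rule integral_norm_bound_integral)
    fix t :: real assume "t \<in> {0..}"
    then show "cmod (of_real t powr (s - 1) / of_real (exp t)) \<le> t powr (Re s - 1) / exp t"
      by (simp add: norm_divide norm_powr_real_powr)
  qed (use c r in \<open>auto simp: has_integral_iff\<close>)
  then show ?thesis
    using integral_unique[OF c] integral_unique[OF r] by simp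
qed

text \<open>\<open>|s + k|\<close> is bounded below both by the distance \<open>d\<close> from the
  pole and by \<open>|Im s|\<close>; this merges the two bounds into a single multiple of
  \<open>1 + |Im s|\<close>.\<close>

lemma max_ge_affine:
  fixes d y :: real
  assumes "d > 0" "y \<ge> 0"
  shows "d / (1 + d) * (1 + y) \<le> max d y"
proof (cases "y \<ge> d")
  case True
  then have "d * (1 + y) \<le> y * (1 + d)" by (simp add: algebra_simps)
  then show ?thesis using assms True by (simp add: field_simps max_def)
next
  case False
  then have "d * (1 + y) \<le> d * (1 + d)" using assms by (intro mult_left_mono) auto
  then show ?thesis using assms False by (simp add: field_simps max_def)
qed

text \<open>Adding \<open>m\<close> moves the strip into \<open>Re s \<ge> 2\<close>, where Gamma is
  bounded because only bounded real parts occur. Dividing by the Pochhammer symbol leads back to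
  \<open>s\<close>, and each of its \<open>m\<close> factors is at least a multiple of
  \<open>1 + |Im s|\<close>.\<close>

lemma Gamma_strip_bound:
  fixes d a :: real and p :: nat
  assumes "d > 0"
  obtains C where "C \<ge> 0"
    "\<And>s. - real p \<le> Re s \<Longrightarrow> Re s \<le> a \<Longrightarrow> (\<And>k. d \<le> cmod (s + of_nat k)) \<Longrightarrow>
       cmod (Gamma s) * (1 + \<bar>Im s\<bar>)\<^sup>2 \<le> C"
proof -
  \<comment> \<open>The summand 2 guarantees two Pochhammer factors, which pay for the square, even
    if \<open>p = 0\<close>.\<close>
  define m where "m = p + 2"
  define c where "c = d / (1 + d)"
  have c: "c > 0" using assms by (simp add: c_def)
  have "bounded (Gamma ` {2..max 2 (a + real m)})"
    by (intro compact_imp_bounded compact_continuous_image continuous_intros)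
       (auto elim!: nonpos_Ints_cases)
  then obtain B where B: "B > 0" "\<And>x. x \<in> {2..max 2 (a + real m)} \<Longrightarrow> \<bar>Gamma x\<bar> \<le> B"
    unfolding bounded_pos by auto
  show ?thesis
  proof
    show "B / c ^ m \<ge> 0" using B c by simp
    fix s :: complex
    assume s: "- real p \<le> Re s" "Re s \<le> a" and d: "\<And>k. d \<le> cmod (s + of_nat k)"
    let ?y = "1 + \<bar>Im s\<bar>"
    have nz: "s \<notin> \<int>\<^sub>\<le>\<^sub>0"
    proof
      assume "s \<in> \<int>\<^sub>\<le>\<^sub>0"
      then obtain n where "s = - of_nat n" by (elim nonpos_Ints_cases')
      then show False using d[of n] assms by simp
    qed
    have fac: "c * ?y \<le> cmod (s + of_nat k)" for k
    proof -
      have "\<bar>Im s\<bar> \<le> cmod (s + of_nat k)"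
        using abs_Im_le_cmod[of "s + of_nat k"] by simp
      then show ?thesis
        using max_ge_affine[OF assms, of "\<bar>Im s\<bar>"] d[of k] by (simp add: c_def)
    qed
    have "c ^ m * ?y\<^sup>2 \<le> c ^ m * ?y ^ m"
      using c by (intro mult_left_mono power_increasing) (auto simp: m_def)
    also have "\<dots> = (\<Prod>k<m. c * ?y)" by (simp add: power_mult_distrib)
    also have "\<dots> \<le> (\<Prod>k<m. cmod (s + of_nat k))"
      using c fac by (intro prod_mono) auto
    also have "\<dots> = cmod (pochhammer s m)"
      by (simp add: pochhammer_prod prod_norm atLeast0LessThan)
    finally have poch: "c ^ m * ?y\<^sup>2 \<le> cmod (pochhammer s m)" .
    have "Gamma s * pochhammer s m = Gamma (s + of_nat m)"
      using nz by (simp add: pochhammer_Gamma Gamma_eq_zero_iff)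
    then have "cmod (Gamma s) * cmod (pochhammer s m) = cmod (Gamma (s + of_nat m))"
      by (metis norm_mult)
    also have "\<dots> \<le> Gamma (Re (s + of_nat m))"
      using s by (intro cmod_Gamma_le) (simp add: m_def)
    also have "\<dots> \<le> B"
      using B(2)[of "Re (s + of_nat m)"] s by (simp add: m_def)
    finally have "cmod (Gamma s) * cmod (pochhammer s m) \<le> B" .
    with mult_left_mono[OF poch, of "cmod (Gamma s)"]
    have "cmod (Gamma s) * (c ^ m * ?y\<^sup>2) \<le> B" by simp
    then show "cmod (Gamma s) * ?y\<^sup>2 \<le> B / c ^ m"
      using c by (simp add: field_simps)
  qed
qed

text \<open>Right of \<open>-p\<close> the strip bound suffices, since \<open>M powr Re s\<close> is
  bounded below there by a positive constant. The region further left is reached by induction on the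
  number of unit steps.\<close>

lemma Gamma_left_bound:
  fixes d M a :: real
  assumes "d > 0" "M > 0"
  obtains C where "C \<ge> 0"
    "\<And>s. Re s \<le> a \<Longrightarrow> (\<And>k. d \<le> cmod (s + of_nat k)) \<Longrightarrow>
       cmod (Gamma s) * (1 + \<bar>Im s\<bar>)\<^sup>2 \<le> C * M powr Re s"
proof -
  \<comment> \<open>\<open>p \<ge> M\<close> gives \<open>|s| \<ge> M\<close> left of
    \<open>-p\<close>, and \<open>p \<ge> 1 - a\<close> keeps \<open>s + 1\<close> in the half-plane
    \<open>Re s \<le> a\<close> during the induction.\<close>
  define p where "p = nat \<lceil>max M (1 - a)\<rceil>"
  have p: "real p \<ge> M" "- real p + 1 \<le> a" by (auto simp: p_def) linarith+
  obtain B where B: "B \<ge> 0"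
    "\<And>s. - real p \<le> Re s \<Longrightarrow> Re s \<le> a \<Longrightarrow> (\<And>k. d \<le> cmod (s + of_nat k)) \<Longrightarrow>
       cmod (Gamma s) * (1 + \<bar>Im s\<bar>)\<^sup>2 \<le> B"
    using Gamma_strip_bound[OF assms(1)] by metis
  \<comment> \<open>The maximum of \<open>M powr (- x)\<close> over \<open>[-p, a]\<close> is
    attained at an endpoint: at \<open>-p\<close> if \<open>M \<ge> 1\<close>, at \<open>a\<close>
    otherwise.\<close>
  define K where "K = max (M powr (real p)) (M powr (- a))"
  have K: "1 \<le> K * M powr x" if "- real p \<le> x" "x \<le> a" for x
  proof (cases "M \<ge> 1")
    case True
    then have "1 \<le> M powr (real p) * M powr x"
      using that by (simp add: powr_add[symmetric] ge_one_powr_ge_zero)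
    also have "\<dots> \<le> K * M powr x" by (intro mult_right_mono) (auto simp: K_def)
    finally show ?thesis .
  next
    case False
    then have "M powr 0 \<le> M powr (- a + x)"
      using that assms by (intro powr_mono') auto
    then have "1 \<le> M powr (- a) * M powr x"
      using assms by (simp add: powr_add[symmetric])
    also have "\<dots> \<le> K * M powr x" by (intro mult_right_mono) (auto simp: K_def)
    finally show ?thesis .
  qed
  have K0: "K \<ge> 0" by (simp add: K_def le_max_iff_disj)
  have base: "cmod (Gamma s) * (1 + \<bar>Im s\<bar>)\<^sup>2 \<le> B * K * M powr Re s"
    if "- real p \<le> Re s" "Re s \<le> a" "\<And>k. d \<le> cmod (s + of_nat k)" for s
  proof -
    have "cmod (Gamma s) * (1 + \<bar>Im s\<bar>)\<^sup>2 \<le> B" by (rule B(2)) (use that in auto)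
    also have "\<dots> \<le> B * (K * M powr Re s)"
      using mult_left_mono[OF K[of "Re s"] B(1)] that by simp
    finally show ?thesis by (simp add: mult.assoc)
  qed
  \<comment> \<open>Left of \<open>-p\<close> one has \<open>|s| \<ge> M\<close>, so each step of the recurrence to the left gains a factor \<open>M\<close>.\<close>
  have main: "cmod (Gamma s) * (1 + \<bar>Im s\<bar>)\<^sup>2 \<le> B * K * M powr Re s"
    if "- real p - real n \<le> Re s" "Re s \<le> a" "\<And>k. d \<le> cmod (s + of_nat k)" for s n
    using that
  proof (induction n arbitrary: s)
    case 0
    then show ?case by (intro base) auto
  next
    case (Suc n)
    show ?case
    proof (cases "- real p \<le> Re s")
      case True
      then show ?thesis using Suc.prems by (intro base) auto
    next
      case False
      have d: "d \<le> cmod (s + 1 + of_nat k)" for k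
        using Suc.prems(3)[of "Suc k"] by (simp add: add_ac)
      have IH: "cmod (Gamma (s + 1)) * (1 + \<bar>Im (s + 1)\<bar>)\<^sup>2 \<le> B * K * M powr Re (s + 1)"
        by (rule Suc.IH) (use Suc.prems False p d in auto)
      have Ms: "M \<le> cmod s" using False p abs_Re_le_cmod[of s] by linarith
      have nz: "s \<notin> \<int>\<^sub>\<le>\<^sub>0"
      proof
        assume "s \<in> \<int>\<^sub>\<le>\<^sub>0"
        then obtain n where "s = - of_nat n" by (elim nonpos_Ints_cases')
        then show False using Suc.prems(3)[of n] assms by simp
      qed
      have eq: "Gamma (s + 1) = s * Gamma s"
        using nz by (rule Gamma_plus1)
      have "M * (cmod (Gamma s) * (1 + \<bar>Im s\<bar>)\<^sup>2) \<le> cmod s * (cmod (Gamma s) * (1 + \<bar>Im s\<bar>)\<^sup>2)"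
        using Ms by (intro mult_right_mono) auto
      also have "\<dots> \<le> B * K * M powr (Re s + 1)"
        using IH by (simp add: eq norm_mult mult_ac)
      also have "\<dots> = M * (B * K * M powr Re s)"
        using assms by (simp add: powr_add)
      finally show ?thesis using assms by simp
    qed
  qed
  show ?thesis
  proof
    show "B * K \<ge> 0" using B K0 by simp
    fix s :: complex assume s: "Re s \<le> a" "\<And>k. d \<le> cmod (s + of_nat k)"
    obtain n :: nat where "- real p - Re s \<le> real n" using real_arch_simple by blast
    then show "cmod (Gamma s) * (1 + \<bar>Im s\<bar>)\<^sup>2 \<le> B * K * M powr Re s"
      using s by (intro main[of n]) auto
  qed
qed

subsection \<open>Vertical line integrals as sums of residues\<close>

text \<open>Reduction to a segment of the real axis, where a contour integral is an ordinary
  integral; the affine map \<open>w \<mapsto> p + w * u\<close> contributes its derivative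
  \<open>u\<close>. Horizontal and vertical edges are the cases \<open>u = 1\<close> and
  \<open>u = \<i>\<close>.\<close>

lemma contour_integral_linepath_affine:
  fixes f :: "complex \<Rightarrow> complex"
  assumes "x1 < x2"
  shows "contour_integral (linepath (p + of_real x1 * u) (p + of_real x2 * u)) f =
    u * integral {x1..x2} (\<lambda>x. f (p + of_real x * u))"
proof -
  have "contour_integral (linepath (p + of_real x1 * u) (p + of_real x2 * u)) f =
      contour_integral (linepath (of_real x1) (of_real x2)) (\<lambda>w. u * f (p + w * u))"
    unfolding contour_integral_integral
    by (intro integral_cong) (auto simp: linepath_def algebra_simps scaleR_conv_of_real)
  also have "\<dots> = integral {x1..x2} (\<lambda>x. u * f (p + of_real x * u))"
    using contour_integral_linepath_Reals_eq[of "of_real x1" "of_real x2"] assms by simp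
  finally show ?thesis by simp
qed

lemma contour_integral_linepath_horizontal:
  fixes f :: "complex \<Rightarrow> complex"
  assumes "x1 < x2"
  shows "contour_integral (linepath (Complex x1 h) (Complex x2 h)) f =
    integral {x1..x2} (\<lambda>x. f (Complex x h))"
proof -
  have "Complex 0 h + of_real x = Complex x h" for x by (simp add: complex_eq_iff)
  then show ?thesis using contour_integral_linepath_affine[OF assms, of "Complex 0 h" 1 f] by simp
qed

lemma contour_integral_linepath_vertical:
  fixes f :: "complex \<Rightarrow> complex"
  assumes "y1 < y2"
  shows "contour_integral (linepath (Complex c y1) (Complex c y2)) f =
    \<i> * integral {y1..y2} (\<lambda>y. f (Complex c y))"
proof -
  have "of_real c + of_real y * \<i> = Complex c y" for y by (simp add: complex_eq_iff)
  then show ?thesis using contour_integral_linepath_affine[OF assms, of "of_real c" \<i> f] by simp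
qed

lemma integrable_inverse_one_plus_square:
  "integrable lborel (\<lambda>x::real. inverse (1 + x\<^sup>2))"
proof -
  have "set_integrable lborel (einterval (- \<infinity>) \<infinity>) (\<lambda>x::real. inverse (1 + x\<^sup>2))"
  proof (rule interval_integral_FTC_nonneg)
    show "DERIV arctan x :> inverse (1 + x\<^sup>2)" for x by (rule DERIV_arctan)
    show "isCont (\<lambda>x::real. inverse (1 + x\<^sup>2)) x" for x
      by (intro continuous_intros) (auto simp: add_nonneg_eq_0_iff)
    show "((arctan \<circ> real_of_ereal) \<longlongrightarrow> - (pi / 2)) (at_right (- \<infinity>))"
      unfolding ereal_tendsto_simps1 by (rule tendsto_arctan_at_bot)
    show "((arctan \<circ> real_of_ereal) \<longlongrightarrow> pi / 2) (at_left \<infinity>)"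
      unfolding ereal_tendsto_simps1 by (rule tendsto_arctan_at_top)
  qed auto
  then show ?thesis by (simp add: set_integrable_def)
qed

lemma integrable_inverse_one_plus_abs_square:
  "integrable lborel (\<lambda>x::real. 1 / (1 + \<bar>x\<bar>)\<^sup>2)"
proof (rule Bochner_Integration.integrable_bound[OF integrable_inverse_one_plus_square])
  show "AE x in lborel. norm (1 / (1 + \<bar>x::real\<bar>)\<^sup>2) \<le> norm (inverse (1 + x\<^sup>2))"
  proof (rule AE_I2)
    fix x :: real
    have "1 + x\<^sup>2 \<le> (1 + \<bar>x\<bar>)\<^sup>2" by (simp add: power2_eq_square algebra_simps)
    moreover have "0 < 1 + x\<^sup>2" by (simp add: add_pos_nonneg)
    ultimately show "norm (1 / (1 + \<bar>x\<bar>)\<^sup>2) \<le> norm (inverse (1 + x\<^sup>2))"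
      by (simp add: field_simps frac_le)
  qed
qed simp

lemma set_integrable_exp_neg: "set_integrable lborel {a..} (\<lambda>x::real. exp (- x))"
proof -
  have "(\<lambda>x::real. exp (- 1 * x)) integrable_on {a..}"
    by (rule integrable_on_exp_minus_to_infinity) simp
  then have "(\<lambda>x::real. exp (- x)) absolutely_integrable_on {a..}"
    by (intro nonnegative_absolutely_integrable_1) auto
  then show ?thesis
    unfolding set_integrable_def by (subst (asm) integrable_completion) auto
qed

text \<open>The residue theorem is applied in the half-plane \<open>Re s > -T - 1\<close>, an open
  set containing the curve. The additional poles between \<open>-T - 1\<close> and \<open>-T\<close>
  do not count: the curve stays in the convex set \<open>Re s \<ge> -T\<close> and does not wind
  around points outside it.\<close>

lemma closed_curve_residues:
  assumes holo: "f holomorphic_on - P" and fin: "\<And>b. finite {p \<in> P. b < Re p}"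
    and path: "valid_path \<gamma>" "pathfinish \<gamma> = pathstart \<gamma>"
    and im: "path_image \<gamma> \<subseteq> {s. - T \<le> Re s} - P"
    and wind: "\<And>p. p \<in> P \<Longrightarrow> - T < Re p \<Longrightarrow> winding_number \<gamma> p = 1"
    and off: "\<And>p. p \<in> P \<Longrightarrow> Re p \<noteq> - T"
  shows "contour_integral \<gamma> f = 2 * of_real pi * \<i> * (\<Sum>p\<in>{p \<in> P. - T < Re p}. residue f p)"
proof -
  let ?S = "{s. - T - 1 < Re s}"
  let ?pts = "{p \<in> P. - T - 1 < Re p}"
  have out: "winding_number \<gamma> p = 0" if "Re p < - T" for p
    using path im that
    by (intro winding_number_zero_outside[of _ "{s. Re s \<ge> - T}"])
       (auto simp: valid_path_imp_path convex_halfspace_Re_ge)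
  have "contour_integral \<gamma> f = 2 * pi * \<i> * (\<Sum>p\<in>?pts. winding_number \<gamma> p * residue f p)"
  proof (rule Residue_theorem)
    show "open ?S" by (rule open_halfspace_Re_gt)
    show "connected ?S" by (intro convex_connected convex_halfspace_Re_gt)
    show "f holomorphic_on ?S - ?pts" by (rule holomorphic_on_subset[OF holo]) auto
    show "path_image \<gamma> \<subseteq> ?S - ?pts" using im by force
    show "\<forall>z. z \<notin> ?S \<longrightarrow> winding_number \<gamma> z = 0" by (auto intro!: out)
  qed (use fin path in auto)
  also have "(\<Sum>p\<in>?pts. winding_number \<gamma> p * residue f p) = (\<Sum>p\<in>{p \<in> P. - T < Re p}. residue f p)"
  proof (rule sum.mono_neutral_cong_right)
    show "\<forall>p\<in>?pts - {p \<in> P. - T < Re p}. winding_number \<gamma> p * residue f p = 0"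
    proof
      fix p assume "p \<in> ?pts - {p \<in> P. - T < Re p}"
      then have "Re p < - T" using off[of p] by auto
      then show "winding_number \<gamma> p * residue f p = 0" by (simp add: out)
    qed
  qed (use fin wind in auto)
  finally show ?thesis by simp
qed

text \<open>The properties shared by \<open>\<Gamma>(s) x powr (-s)\<close> and the Meijer integrand
  that the contour arguments rely on. In \<open>decay\<close> the exponential factor controls left
  edges and rays to \<open>-\<infinity>\<close>, the quadratic one controls vertical lines and the
  top and bottom of large rectangles. By \<open>gap\<close> the lines
  \<open>Re s = -(t0 + n)\<close> keep the distance \<open>\<delta>\<close> from all poles,
  uniformly in \<open>n\<close>.\<close>

locale left_decaying =
  fixes f :: "complex \<Rightarrow> complex" and P :: "complex set" and t0 \<delta> :: real
  assumes holo: "f holomorphic_on - P"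
    and P_real: "p \<in> P \<Longrightarrow> Im p = 0"
    and P_nonpos: "p \<in> P \<Longrightarrow> Re p \<le> 0"
    and P_fin: "finite {p \<in> P. b < Re p}"
    and t0_pos: "0 < t0" and \<delta>_pos: "0 < \<delta>"
    and gap: "p \<in> P \<Longrightarrow> \<delta> \<le> \<bar>Re p + (t0 + real n)\<bar>"
    and decay: "0 < d \<Longrightarrow> \<exists>C\<ge>0. \<forall>s. Re s \<le> c \<longrightarrow> (\<forall>p\<in>P. d \<le> cmod (s - p)) \<longrightarrow>
      cmod (f s) \<le> C * exp (Re s) / (1 + \<bar>Im s\<bar>)\<^sup>2"
begin

definition residue_sum :: "nat \<Rightarrow> complex" where
  "residue_sum n = (\<Sum>p\<in>{p \<in> P. - (t0 + real n) < Re p}. residue f p)"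

lemma continuous: "continuous_on (- P) f"
  by (rule holomorphic_on_imp_continuous_on[OF holo])

lemma integrable_linepath:
  assumes "closed_segment a b \<inter> P = {}"
  shows "f contour_integrable_on linepath a b"
  using assms
  by (intro contour_integrable_continuous_linepath continuous_on_subset[OF continuous]) auto

lemma notin_P: "s \<notin> P" if "Im s \<noteq> 0 \<or> 0 < Re s \<or> Re s = - (t0 + real n)"
  using that P_real[of s] P_nonpos[of s] gap[of s n] \<delta>_pos by auto

text \<open>No pole has positive real part, so the line keeps the distance \<open>c\<close> from all
  of them and \<open>decay\<close> yields the integrable majorant
  \<open>1 / (1 + |y|)^2\<close>.\<close>

lemma integrable_vertical_line:
  assumes "0 < c"
  shows "integrable lborel (\<lambda>y. f (Complex c y))"
proof -
  obtain C where C: "C \<ge> 0" "\<And>s. Re s \<le> c \<Longrightarrow> (\<forall>p\<in>P. c \<le> cmod (s - p)) \<Longrightarrow>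
      cmod (f s) \<le> C * exp (Re s) / (1 + \<bar>Im s\<bar>)\<^sup>2"
    using decay[OF assms, of c] by blast
  have bound: "cmod (f (Complex c y)) \<le> C * exp c * (1 / (1 + \<bar>y\<bar>)\<^sup>2)" for y
  proof -
    have "c \<le> cmod (Complex c y - p)" if "p \<in> P" for p
      using abs_Re_le_cmod[of "Complex c y - p"] P_nonpos[OF that] by simp
    then show ?thesis using C(2)[of "Complex c y"] by simp
  qed
  have "continuous_on UNIV (\<lambda>y. Complex c y)"
    by (simp add: Complex_eq) (intro continuous_intros)
  then have "continuous_on UNIV (\<lambda>y. f (Complex c y))"
    by (intro continuous_on_compose2[OF continuous]) (use assms in \<open>auto dest: P_nonpos\<close>)
  then have "(\<lambda>y. f (Complex c y)) \<in> borel_measurable borel"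
    by (rule borel_measurable_continuous_onI)
  moreover have "integrable lborel (\<lambda>y. C * exp c * (1 / (1 + \<bar>y\<bar>)\<^sup>2))"
    by (intro integrable_mult_right integrable_inverse_one_plus_abs_square)
  ultimately show ?thesis
    by (intro Bochner_Integration.integrable_bound[of _ _ "\<lambda>y. f (Complex c y)"])
       (auto intro!: AE_I2 order.trans[OF bound] simp: abs_mult C)
qed

text \<open>The integrand is \<open>O(exp (-n))\<close> on the edge, which beats its length. The
  heights may depend on \<open>n\<close>, so that the growing edges of rectangles and the fixed edge
  closing a loop are both covered.\<close>

lemma contour_integral_left_edge_tendsto_0:
  fixes y1 y2 :: "nat \<Rightarrow> real"
  assumes "\<And>n. \<bar>y2 n - y1 n\<bar> \<le> K * (1 + real n)"
  shows "(\<lambda>n. contour_integral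
    (linepath (Complex (- (t0 + real n)) (y1 n)) (Complex (- (t0 + real n)) (y2 n))) f) \<longlonglongrightarrow> 0"
proof -
  obtain C where C: "C \<ge> 0" "\<And>s. Re s \<le> 0 \<Longrightarrow> (\<forall>p\<in>P. \<delta> \<le> cmod (s - p)) \<Longrightarrow>
      cmod (f s) \<le> C * exp (Re s) / (1 + \<bar>Im s\<bar>)\<^sup>2"
    using decay[OF \<delta>_pos, of 0] by blast
  have bound: "cmod (contour_integral
    (linepath (Complex (- (t0 + real n)) (y1 n)) (Complex (- (t0 + real n)) (y2 n))) f) \<le>
      C * exp (- real n) * (K * (1 + real n))" (is "?I \<le> _") for n
  proof -
    let ?a = "Complex (- (t0 + real n)) (y1 n)" and ?b = "Complex (- (t0 + real n)) (y2 n)"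
    have Re: "Re s = - (t0 + real n)" if "s \<in> closed_segment ?a ?b" for s
      using that by (auto simp: closed_segment_same_Re)
    have "?I \<le> C * exp (- real n) * cmod (?b - ?a)"
    proof (rule contour_integral_bound_linepath)
      show "f contour_integrable_on linepath ?a ?b"
        using Re notin_P by (intro integrable_linepath) blast
      fix s assume s: "s \<in> closed_segment ?a ?b"
      have "\<delta> \<le> cmod (s - p)" if "p \<in> P" for p
        using gap[OF that, of n] abs_Re_le_cmod[of "s - p"] Re[OF s] by auto
      then have "cmod (f s) \<le> C * exp (Re s) / (1 + \<bar>Im s\<bar>)\<^sup>2"
        using Re[OF s] t0_pos by (intro C) auto
      also have "\<dots> \<le> C * exp (Re s) / 1"
        using C(1) by (intro divide_left_mono) auto
      also have "\<dots> \<le> C * exp (- real n)"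
        using C(1) t0_pos Re[OF s] by (auto intro!: mult_left_mono)
      finally show "cmod (f s) \<le> C * exp (- real n)" .
    qed (use C in auto)
    also have "cmod (?b - ?a) = \<bar>y2 n - y1 n\<bar>"
      by (simp add: cmod_def)
    also have "C * exp (- real n) * \<bar>y2 n - y1 n\<bar> \<le> C * exp (- real n) * (K * (1 + real n))"
      using assms C by (intro mult_left_mono) auto
    finally show ?thesis .
  qed
  have lim: "(\<lambda>n. C * exp (- real n) * (K * (1 + real n))) \<longlonglongrightarrow> 0"
  proof -
    have "(\<lambda>n. exp (- real n) * (1 + real n)) \<longlonglongrightarrow> 0"
      by real_asymp
    from tendsto_mult_right_zero[OF this, of "C * K"] show ?thesis
      by (simp add: mult_ac)
  qed
  show ?thesis by (rule Lim_null_comparison[OF always_eventually lim]) (use bound in blast)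
qed

text \<open>The integrand is \<open>O(1 / n^2)\<close> at height \<open>1 + n\<close> while the
  length grows only linearly. As the poles are real, this edge has distance at least 1 from
  them.\<close>

lemma contour_integral_horizontal_edge_tendsto_0:
  assumes "0 < c" "\<And>n. \<bar>h n\<bar> = 1 + real n"
  shows "(\<lambda>n. contour_integral
    (linepath (Complex (- (t0 + real n)) (h n)) (Complex c (h n))) f) \<longlonglongrightarrow> 0"
proof -
  obtain C where C: "C \<ge> 0" "\<And>s. Re s \<le> c \<Longrightarrow> (\<forall>p\<in>P. 1 \<le> cmod (s - p)) \<Longrightarrow>
      cmod (f s) \<le> C * exp (Re s) / (1 + \<bar>Im s\<bar>)\<^sup>2"
    using decay[of 1 c] by auto
  have bound: "cmod (contour_integral
    (linepath (Complex (- (t0 + real n)) (h n)) (Complex c (h n))) f) \<le>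
      C * exp c / (1 + (1 + real n))\<^sup>2 * (c + (t0 + real n))" (is "?I \<le> _") for n
  proof -
    let ?a = "Complex (- (t0 + real n)) (h n)" and ?b = "Complex c (h n)"
    have s: "Im s = h n" "Re s \<le> c" if "s \<in> closed_segment ?a ?b" for s
      using that assms(1) t0_pos
      by (auto simp: closed_segment_same_Im closed_segment_eq_real_ivl split: if_splits)
    have h: "h n \<noteq> 0" using assms(2)[of n] by auto
    have "?I \<le> C * exp c / (1 + (1 + real n))\<^sup>2 * cmod (?b - ?a)"
    proof (rule contour_integral_bound_linepath)
      show "f contour_integrable_on linepath ?a ?b"
        using h using s(1) notin_P by (intro integrable_linepath) fastforce
      fix w assume w: "w \<in> closed_segment ?a ?b"
      have "1 \<le> cmod (w - p)" if "p \<in> P" for p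
        using abs_Im_le_cmod[of "w - p"] s[OF w] P_real[OF that] assms(2)[of n] by auto
      then have "cmod (f w) \<le> C * exp (Re w) / (1 + \<bar>Im w\<bar>)\<^sup>2"
        using s[OF w] by (intro C) auto
      also have "\<dots> \<le> C * exp c / (1 + (1 + real n))\<^sup>2"
        using C(1) s[OF w] assms(2)[of n] by (auto intro!: divide_right_mono mult_left_mono)
      finally show "cmod (f w) \<le> C * exp c / (1 + (1 + real n))\<^sup>2" .
    qed (use C in auto)
    also have "cmod (?b - ?a) = c + (t0 + real n)"
      using assms t0_pos by (simp add: cmod_def)
    finally show ?thesis .
  qed
  have lim: "(\<lambda>n. C * exp c / (1 + (1 + real n))\<^sup>2 * (c + (t0 + real n))) \<longlonglongrightarrow> 0"
  proof -
    have "(\<lambda>n. 1 / (1 + (1 + real n))\<^sup>2) \<longlonglongrightarrow> 0" "(\<lambda>n. real n / (1 + (1 + real n))\<^sup>2) \<longlonglongrightarrow> 0"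
      by real_asymp+
    from tendsto_add[OF tendsto_mult_right_zero[OF this(1), of "C * exp c * (c + t0)"]
        tendsto_mult_right_zero[OF this(2), of "C * exp c"]]
    show ?thesis by (simp add: algebra_simps add_divide_distrib)
  qed
  show ?thesis by (rule Lim_null_comparison[OF always_eventually lim]) (use bound in blast)
qed

lemma integral_vertical_line_limit:
  assumes "0 < c"
  shows "(\<lambda>n. contour_integral (linepath (Complex c (- (1 + real n))) (Complex c (1 + real n))) f)
    \<longlonglongrightarrow> \<i> * (LINT y|lborel. f (Complex c y))"
proof -
  let ?g = "\<lambda>y. f (Complex c y)"
  have int: "set_integrable lborel A ?g" if "A \<in> sets borel" for A
    using that integrable_vertical_line[OF assms]
    unfolding set_integrable_def by (intro integrable_mult_indicator) simp_all
  have un: "(\<Union>n. {- (1 + real n)..1 + real n}) = UNIV"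
  proof (intro equalityI subsetI)
    fix x :: real
    obtain n :: nat where "\<bar>x\<bar> \<le> real n" using real_arch_simple by blast
    then show "x \<in> (\<Union>n. {- (1 + real n)..1 + real n})" by (auto intro!: exI[of _ n])
  qed auto
  have "(\<lambda>n. LINT y:{- (1 + real n)..1 + real n}|lborel. ?g y)
      \<longlonglongrightarrow> (LINT y:(\<Union>n. {- (1 + real n)..1 + real n})|lborel. ?g y)"
    by (intro set_integral_cont_up) (auto simp: incseq_def un int)
  moreover have "(LINT y:{- (1 + real n)..1 + real n}|lborel. ?g y) =
      integral {- (1 + real n)..1 + real n} ?g" for n
    by (intro set_borel_integral_eq_integral int) auto
  ultimately have "(\<lambda>n. integral {- (1 + real n)..1 + real n} ?g) \<longlonglongrightarrow> (LINT y|lborel. ?g y)"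
    unfolding un by (simp add: set_lebesgue_integral_def)
  then show ?thesis
    by (subst contour_integral_linepath_vertical) (auto intro!: tendsto_intros)
qed

text \<open>The rectangle with real parts from \<open>-(t0 + n)\<close> to \<open>c\<close> and
  imaginary parts from \<open>-(1 + n)\<close> to \<open>1 + n\<close> encloses exactly the poles
  counted in \<open>residue_sum n\<close>. As \<open>n\<close> grows, three of its edges contribute
  nothing and the right edge becomes the whole vertical line.\<close>

lemma residue_sum_limit:
  assumes "0 < c"
  shows "residue_sum \<longlonglongrightarrow> (LINT y|lborel. f (Complex c y)) / (2 * of_real pi)"
proof -
  let ?lb = "\<lambda>n. Complex (- (t0 + real n)) (- (1 + real n))"
  let ?rb = "\<lambda>n. Complex c (- (1 + real n))"
  let ?rt = "\<lambda>n. Complex c (1 + real n)"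
  let ?lt = "\<lambda>n. Complex (- (t0 + real n)) (1 + real n)"
  let ?I = "\<lambda>a b. contour_integral (linepath a b) f"
  have res: "?I (?lb n) (?rb n) + (?I (?rb n) (?rt n) + (?I (?rt n) (?lt n) + ?I (?lt n) (?lb n)))
      = 2 * of_real pi * \<i> * residue_sum n" for n
  proof -
    let ?r = "rectpath (?lb n) (?rt n)"
    have le: "Re (?lb n) \<le> Re (?rt n)" "Im (?lb n) \<le> Im (?rt n)"
      using assms t0_pos by auto
    have img: "path_image ?r \<subseteq> {s. - (t0 + real n) \<le> Re s} - P"
    proof
      fix s assume "s \<in> path_image ?r"
      then have "- (t0 + real n) \<le> Re s" "Re s = - (t0 + real n) \<or> Re s = c \<or> Im s \<noteq> 0"
        using assms t0_pos unfolding path_image_rectpath[OF le] by auto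
      then show "s \<in> {s. - (t0 + real n) \<le> Re s} - P"
        using notin_P[of s n] assms by auto
    qed
    have "contour_integral ?r f = 2 * of_real pi * \<i> * residue_sum n"
      unfolding residue_sum_def
    proof (rule closed_curve_residues[OF holo P_fin])
      fix p assume p: "p \<in> P"
      show "Re p \<noteq> - (t0 + real n)" using notin_P[of p n] p by blast
      assume "- (t0 + real n) < Re p"
      then show "winding_number ?r p = 1"
        using P_nonpos[OF p] P_real[OF p] assms
        by (intro winding_number_rectpath) (auto simp: in_box_complex_iff)
    qed (use img in auto)
    moreover have int: "f contour_integrable_on linepath (?lb n) (?rb n)"
      "f contour_integrable_on linepath (?rb n) (?rt n)"
      "f contour_integrable_on linepath (?rt n) (?lt n)"
      "f contour_integrable_on linepath (?lt n) (?lb n)"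
      by (rule integrable_linepath, use img in \<open>force simp: rectpath_def Let_def path_image_join\<close>)+
    ultimately show ?thesis
      by (simp add: rectpath_def Let_def)
  qed
  have "(\<lambda>n. ?I (?lb n) (?rb n) + (?I (?rb n) (?rt n) + (- ?I (?lt n) (?rt n) + ?I (?lt n) (?lb n))))
      \<longlonglongrightarrow> 0 + (\<i> * (LINT y|lborel. f (Complex c y)) + (- 0 + 0))"
    by (intro tendsto_add tendsto_minus integral_vertical_line_limit
      contour_integral_left_edge_tendsto_0[where K = 2]
      contour_integral_horizontal_edge_tendsto_0 assms) auto
  \<comment> \<open>The rectangle traverses its top edge from right to left, whereas the edge
    estimate is stated from left to right.\<close>
  moreover have rev: "- ?I (?lt n) (?rt n) = ?I (?rt n) (?lt n)" for n
    by (metis contour_integral_reversepath reversepath_linepath valid_path_linepath)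
  ultimately have "(\<lambda>n. 2 * of_real pi * \<i> * residue_sum n)
      \<longlonglongrightarrow> 0 + (\<i> * (LINT y|lborel. f (Complex c y)) + (- 0 + 0))"
    by (simp only: rev res)
  from tendsto_divide[OF this tendsto_const[of "2 * of_real pi * \<i>"]] show ?thesis
    by simp
qed

end

subsection \<open>Loop integrals\<close>

lemma valid_path_loops:
  assumes "valid_path g"
  shows "valid_path (trunc_loop g S T)" "valid_path (closed_loop g T)"
    "pathfinish (closed_loop g T) = pathstart (closed_loop g T)"
  using assms by (auto simp: trunc_loop_def closed_loop_def)

lemma path_image_closed_loop:
  assumes "valid_path g"
  shows "path_image (closed_loop g T) =
    closed_segment (Complex (- T) (Im (pathstart g))) (pathstart g) \<union> path_image g \<union>
    closed_segment (pathfinish g) (Complex (- T) (Im (pathfinish g))) \<union>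
    closed_segment (Complex (- T) (Im (pathfinish g))) (Complex (- T) (Im (pathstart g)))"
  using assms by (auto simp: trunc_loop_def closed_loop_def path_image_join)

lemma contour_integral_trunc_loop:
  assumes "valid_path g" "f contour_integrable_on g"
    "f contour_integrable_on linepath (Complex (- S) (Im (pathstart g))) (pathstart g)"
    "f contour_integrable_on linepath (pathfinish g) (Complex (- T) (Im (pathfinish g)))"
  shows "f contour_integrable_on trunc_loop g S T"
    "contour_integral (trunc_loop g S T) f =
      contour_integral (linepath (Complex (- S) (Im (pathstart g))) (pathstart g)) f +
      contour_integral g f +
      contour_integral (linepath (pathfinish g) (Complex (- T) (Im (pathfinish g)))) f"
  using assms by (auto simp: trunc_loop_def)

lemma contour_integral_closed_loop:
  assumes "valid_path g" "f contour_integrable_on trunc_loop g T T"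
    "f contour_integrable_on
      linepath (Complex (- T) (Im (pathfinish g))) (Complex (- T) (Im (pathstart g)))"
  shows "contour_integral (closed_loop g T) f = contour_integral (trunc_loop g T T) f +
      contour_integral
        (linepath (Complex (- T) (Im (pathfinish g))) (Complex (- T) (Im (pathstart g)))) f"
proof -
  have "pathstart (trunc_loop g T T) = Complex (- T) (Im (pathstart g))"
    "pathfinish (trunc_loop g T T) = Complex (- T) (Im (pathfinish g))"
    by (simp_all add: trunc_loop_def)
  then show ?thesis using assms valid_path_loops(1) by (simp add: closed_loop_def)
qed

text \<open>The two loops differ only by pieces inside the convex half-plane
  \<open>Re s < r\<close>, where \<open>f\<close> has a primitive \<open>F\<close>. The rays are
  split at real part \<open>-T\<close>: the parts to the right are common to both loops, the others
  are differences of values of \<open>F\<close>.\<close>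

lemma contour_integral_closed_loop_shift:
  assumes g: "valid_path g" "f contour_integrable_on g"
    and T: "T \<le> T'" "- T < r" "- T \<le> Re (pathstart g)" "- T \<le> Re (pathfinish g)"
    and holo: "f holomorphic_on {s. Re s < r}"
    and cont: "continuous_on (path_image (closed_loop g T')) f"
  shows "contour_integral (closed_loop g T) f = contour_integral (closed_loop g T') f"
proof -
  let ?H = "{s. Re s < r}"
  define a b where "a = pathstart g" and "b = pathfinish g"
  define q q' where "q = Complex (- T) (Im a)" and "q' = Complex (- T') (Im a)"
  define w w' where "w = Complex (- T) (Im b)" and "w' = Complex (- T') (Im b)"
  note defs = a_def b_def q_def q'_def w_def w'_def
  let ?I = "\<lambda>a b. contour_integral (linepath a b) f"
  have inH: "q \<in> ?H" "q' \<in> ?H" "w \<in> ?H" "w' \<in> ?H" using T by (auto simp: defs)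
  obtain F where F: "\<And>x. x \<in> ?H \<Longrightarrow> (F has_field_derivative f x) (at x within ?H)"
    by (rule holomorphic_convex_primitive'[OF convex_halfspace_Re_lt open_halfspace_Re_lt holo]) blast
  have prim: "(f has_contour_integral F y - F x) (linepath x y)" if "x \<in> ?H" "y \<in> ?H" for x y
    using contour_integral_primitive[of ?H F f "linepath x y", OF F] that
      convex_contains_segment[of ?H] by (simp add: convex_halfspace_Re_lt)
  have prim': "f contour_integrable_on linepath x y" "?I x y = F y - F x"
    if "x \<in> ?H" "y \<in> ?H" for x y
    using prim[OF that] by (auto simp: contour_integrable_on_def intro: contour_integral_unique)
  have cont': "continuous_on (closed_segment q' a) f" "continuous_on (closed_segment b w') f"
    using cont unfolding path_image_closed_loop[OF g(1)]
    by (auto intro: continuous_on_subset simp: defs)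
  have seg: "q \<in> closed_segment q' a" "w \<in> closed_segment b w'"
    using T by (auto simp: defs closed_segment_same_Im closed_segment_eq_real_ivl)
  then have sub: "closed_segment q a \<subseteq> closed_segment q' a" "closed_segment b w \<subseteq> closed_segment b w'"
    by (auto simp: subset_closed_segment)
  have int: "f contour_integrable_on linepath q' a" "f contour_integrable_on linepath q a"
    "f contour_integrable_on linepath b w'" "f contour_integrable_on linepath b w"
    using cont' sub by (auto intro!: contour_integrable_continuous_linepath intro: continuous_on_subset)
  have split: "?I q' a = ?I q' q + ?I q a" "?I b w' = ?I b w + ?I w w'"
    using cont' seg by (auto intro!: contour_integral_split_linepath)
  have "contour_integral (closed_loop g T) f = ?I q a + contour_integral g f + ?I b w + ?I w q"
    using contour_integral_trunc_loop[of g f T T] contour_integral_closed_loop[of g f T]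
      g int prim' inH by (auto simp: defs)
  moreover have "contour_integral (closed_loop g T') f =
      ?I q' a + contour_integral g f + ?I b w' + ?I w' q'"
    using contour_integral_trunc_loop[of g f T' T'] contour_integral_closed_loop[of g f T']
      g int prim' inH by (auto simp: defs)
  ultimately show ?thesis
    using prim' inH by (simp add: split)
qed

text \<open>\<open>loop_index\<close> speaks only of sufficiently large cut-offs. To obtain the same
  index at a given cut-off left of \<open>p\<close> and of both ends of \<open>g\<close>, the loop
  is shifted for the function \<open>1 / (s - p)\<close>, which is holomorphic left of
  \<open>p\<close>.\<close>

lemma winding_number_closed_loop:
  assumes g: "valid_path g" and idx: "loop_index g p k"
    and T: "- T < Re p" "- T \<le> Re (pathstart g)" "- T \<le> Re (pathfinish g)"
  shows "p \<notin> path_image (closed_loop g T)" "winding_number (closed_loop g T) p = k"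
proof -
  let ?f = "\<lambda>s. 1 / (s - p)"
  obtain T' where T': "T' \<ge> T" "p \<notin> path_image (closed_loop g T')"
    "winding_number (closed_loop g T') p = k"
    using eventually_conj[OF idx[unfolded loop_index_def] eventually_ge_at_top[of T]]
    unfolding eventually_at_top_linorder by blast
  have sub1: "closed_segment (Complex (- T) (Im (pathstart g))) (pathstart g) \<subseteq>
      closed_segment (Complex (- T') (Im (pathstart g))) (pathstart g)"
    using T T'(1) by (auto simp: subset_closed_segment closed_segment_same_Im closed_segment_eq_real_ivl)
  have sub2: "closed_segment (pathfinish g) (Complex (- T) (Im (pathfinish g))) \<subseteq>
      closed_segment (pathfinish g) (Complex (- T') (Im (pathfinish g)))"
    using T T'(1) by (auto simp: subset_closed_segment closed_segment_same_Im closed_segment_eq_real_ivl)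
  show notin: "p \<notin> path_image (closed_loop g T)"
    using T'(2) sub1 sub2 T unfolding path_image_closed_loop[OF g]
    by (auto simp: closed_segment_same_Re)
  have "p \<notin> path_image g" using T'(2) by (auto simp: path_image_closed_loop[OF g])
  then have "?f contour_integrable_on g"
    using g contour_integrable_inversediff by blast
  then have "contour_integral (closed_loop g T) ?f = contour_integral (closed_loop g T') ?f"
    by (rule contour_integral_closed_loop_shift[OF g _ T'(1) T])
       (use T'(2) in \<open>auto intro!: holomorphic_intros continuous_intros\<close>)
  then show "winding_number (closed_loop g T) p = k"
    using T' notin g by (simp add: winding_number_valid_path valid_path_loops)
qed

section \<open>Convergence and value of integrals over infinite loops\<close>

context left_decaying
begin

text \<open>A ray at height \<open>h \<noteq> 0\<close> has distance at least \<open>|h|\<close>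
  from the real poles, so the integrand is dominated by a multiple of \<open>exp (Re s)\<close>
  along it.\<close>

lemma ray_convergent:
  assumes "h \<noteq> 0"
  obtains L where
    "((\<lambda>S. contour_integral (linepath (Complex (- S) h) (Complex a h)) f) \<longlongrightarrow> L) at_top"
proof -
  \<comment> \<open>The reflection turns the ray into one going to \<open>+\<infinity>\<close>, as
    the limit theorem for growing upper bounds expects.\<close>
  define g where "g = (\<lambda>x. f (Complex (- x) h))"
  obtain C where C: "C \<ge> 0" "\<And>s. Re s \<le> a \<Longrightarrow> (\<forall>p\<in>P. \<bar>h\<bar> \<le> cmod (s - p)) \<Longrightarrow>
      cmod (f s) \<le> C * exp (Re s) / (1 + \<bar>Im s\<bar>)\<^sup>2"
    using decay[of "\<bar>h\<bar>" a] assms by auto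
  have bound: "cmod (g x) \<le> C * exp (- x)" if "x \<ge> - a" for x
  proof -
    have "\<bar>h\<bar> \<le> cmod (Complex (- x) h - p)" if "p \<in> P" for p
      using abs_Im_le_cmod[of "Complex (- x) h - p"] P_real[OF that] by simp
    then have "cmod (g x) \<le> C * exp (- x) / (1 + \<bar>h\<bar>)\<^sup>2"
      using C(2)[of "Complex (- x) h"] that by (simp add: g_def)
    also have "\<dots> \<le> C * exp (- x) / 1"
      using C(1) by (intro divide_left_mono) auto
    finally show ?thesis by simp
  qed
  have "continuous_on UNIV (\<lambda>x. Complex (- x) h)"
    by (simp add: Complex_eq) (intro continuous_intros)
  then have cont: "continuous_on UNIV g" unfolding g_def
    by (intro continuous_on_compose2[OF continuous]) (use assms in \<open>auto dest: P_real\<close>)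
  have int: "set_integrable lborel {- a..} g"
    unfolding set_integrable_def
  proof (rule Bochner_Integration.integrable_bound)
    show "integrable lborel (\<lambda>x. C * (indicator {- a..} x *\<^sub>R exp (- x)))"
      using set_integrable_exp_neg[of "- a"] unfolding set_integrable_def
      by (rule integrable_mult_right)
    show "(\<lambda>x. indicat_real {- a..} x *\<^sub>R g x) \<in> borel_measurable lborel"
      using borel_measurable_continuous_onI[OF cont] by measurable
    show "AE x in lborel. norm (indicat_real {- a..} x *\<^sub>R g x)
        \<le> norm (C * (indicator {- a..} x *\<^sub>R exp (- x)))"
      using bound C(1) by (auto intro!: AE_I2 simp: indicator_def)
  qed
  let ?L = "LINT x|lborel. indicator {- a..} x *\<^sub>R g x"
  have "((\<lambda>S. LINT x|lborel. indicator {..S} x *\<^sub>R (indicator {- a..} x *\<^sub>R g x)) \<longlongrightarrow> ?L) at_top"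
    using int by (intro tendsto_integral_at_top) (auto simp: set_integrable_def)
  moreover have "\<forall>\<^sub>F S in at_top. (LINT x|lborel. indicator {..S} x *\<^sub>R (indicator {- a..} x *\<^sub>R g x)) =
      contour_integral (linepath (Complex (- S) h) (Complex a h)) f"
    using eventually_gt_at_top[of "- a"]
  proof eventually_elim
    case (elim S)
    have "(LINT x|lborel. indicator {..S} x *\<^sub>R (indicator {- a..} x *\<^sub>R g x)) =
        (LINT x:{- a..S}|lborel. g x)"
      unfolding set_lebesgue_integral_def
      by (intro Bochner_Integration.integral_cong) (auto simp: indicator_def)
    also have "\<dots> = integral {- a..S} g"
      by (intro set_borel_integral_eq_integral set_integrable_subset[OF int]) auto
    also have "\<dots> = integral {- S..a} (\<lambda>x. f (Complex x h))"
      using Henstock_Kurzweil_Integration.integral_reflect_real[of S "- a" "\<lambda>x. f (Complex x h)"]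
        Henstock_Kurzweil_Integration.integral_reflect_real[of a "- S" "\<lambda>x. f (Complex x h)"]
      by (simp add: g_def)
    also have "\<dots> = contour_integral (linepath (Complex (- S) h) (Complex a h)) f"
      using elim by (intro contour_integral_linepath_horizontal[symmetric]) simp
    finally show ?case .
  qed
  ultimately show ?thesis by (intro that) (rule Lim_transform_eventually)
qed

text \<open>Each ray integral converges by itself, so the two cut-offs may tend to infinity
  independently. The value is then determined along the diagonal \<open>S = T = t0 + n\<close>:
  adding the vertical edge closes the loop, the residue theorem gives \<open>residue_sum n\<close>,
  and the added edge vanishes in the limit.\<close>

lemma loop_integral_limit:
  assumes g: "valid_path g" and idx: "\<And>p. p \<in> P \<Longrightarrow> loop_index g p 1"
    and unbounded: "\<And>b. \<exists>p\<in>P. Re p < b" and lim: "residue_sum \<longlonglongrightarrow> L"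
  shows "((\<lambda>(S, T). 1 / (2 * of_real pi * \<i>) * contour_integral (trunc_loop g S T) f) \<longlongrightarrow> L)
    (at_top \<times>\<^sub>F at_top)"
proof -
  define a b where "a = pathstart g" and "b = pathfinish g"
  have avoid: "p \<notin> path_image (closed_loop g T) \<and> winding_number (closed_loop g T) p = 1"
    if "p \<in> P" "- T < Re p" "- T \<le> Re a" "- T \<le> Re b" for p T
    using winding_number_closed_loop[OF g idx[OF that(1)]] that by (auto simp: a_def b_def)
  have gP: "path_image g \<inter> P = {}"
  proof -
    have "p \<notin> path_image g" if "p \<in> P" for p
    proof -
      obtain T where "p \<notin> path_image (closed_loop g T)"
        using idx[OF \<open>p \<in> P\<close>] unfolding loop_index_def eventually_at_top_linorder by blast
      then show ?thesis by (simp add: path_image_closed_loop[OF g])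
    qed
    then show ?thesis by blast
  qed
  \<comment> \<open>A ray on the real axis would run through all poles that are far enough to the left.\<close>
  have off: "Im a \<noteq> 0" "Im b \<noteq> 0"
  proof -
    obtain p where p: "p \<in> P" "Re p < min (Re a) (Re b)" using unbounded by blast
    define T where "T = 1 - Re p"
    have *: "p \<notin> path_image (closed_loop g T)"
      using avoid[OF p(1), of T] p by (auto simp: T_def)
    show "Im a \<noteq> 0" "Im b \<noteq> 0"
      using * P_real[OF p(1)] p unfolding path_image_closed_loop[OF g]
      by (auto simp: closed_segment_same_Im closed_segment_eq_real_ivl T_def a_def b_def)
  qed
  have "bounded (path_image g)"
    using g by (simp add: bounded_path_image valid_path_imp_path)
  then obtain K where K: "\<And>s. s \<in> path_image g \<Longrightarrow> cmod s \<le> K"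
    by (auto simp: bounded_iff)
  let ?A = "\<lambda>S. contour_integral (linepath (Complex (- S) (Im a)) a) f"
  let ?B = "\<lambda>T. contour_integral (linepath b (Complex (- T) (Im b))) f"
  have int: "f contour_integrable_on linepath (Complex (- S) (Im a)) a"
    "f contour_integrable_on linepath b (Complex (- S) (Im b))" for S
    using off P_real by (auto intro!: integrable_linepath simp: closed_segment_same_Im)
  \<comment> \<open>Only finitely many poles lie right of \<open>-(K + 1)\<close>, so removing them
    from that half-plane leaves an open set containing \<open>g\<close>.\<close>
  have intg: "f contour_integrable_on g"
  proof (rule contour_integrable_holomorphic_simple[OF _ _ g])
    let ?S = "{s. - (K + 1) < Re s} - {p \<in> P. - (K + 1) < Re p}"
    show "f holomorphic_on ?S" by (rule holomorphic_on_subset[OF holo]) auto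
    show "open ?S"
      by (intro open_Diff open_halfspace_Re_gt finite_imp_closed P_fin)
    show "path_image g \<subseteq> ?S"
    proof
      fix s assume s: "s \<in> path_image g"
      then have "- (K + 1) < Re s"
        using K[OF s] abs_Re_le_cmod[of s] by linarith
      then show "s \<in> ?S" using s gP by auto
    qed
  qed
  have trunc: "f contour_integrable_on trunc_loop g S T"
    "contour_integral (trunc_loop g S T) f = ?A S + contour_integral g f + ?B T" for S T
    using contour_integral_trunc_loop[OF g intg] int by (auto simp: a_def b_def)
  obtain LA where LA: "(?A \<longlongrightarrow> LA) at_top"
    using ray_convergent[OF off(1), of "Re a"] by auto
  obtain LB where LB: "((\<lambda>T. contour_integral (linepath (Complex (- T) (Im b)) b) f) \<longlongrightarrow> LB) at_top"
    using ray_convergent[OF off(2), of "Re b"] by auto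
  have "?B T = - contour_integral (linepath (Complex (- T) (Im b)) b) f" for T
    by (metis contour_integral_reversepath reversepath_linepath valid_path_linepath)
  then have LB': "(?B \<longlongrightarrow> - LB) at_top" using tendsto_minus[OF LB] by simp
  define L' where "L' = 1 / (2 * of_real pi * \<i>) * (LA + contour_integral g f + - LB)"
  have "((\<lambda>ST. 1 / (2 * of_real pi * \<i>) * (?A (fst ST) + contour_integral g f + ?B (snd ST)))
      \<longlongrightarrow> L') (at_top \<times>\<^sub>F at_top)"
    unfolding L'_def
    by (intro tendsto_mult tendsto_add tendsto_const filterlim_compose[OF LA filterlim_fst]
      filterlim_compose[OF LB' filterlim_snd])
  then have main: "((\<lambda>(S, T). 1 / (2 * of_real pi * \<i>) * contour_integral (trunc_loop g S T) f)
      \<longlongrightarrow> L') (at_top \<times>\<^sub>F at_top)"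
    by (simp add: trunc case_prod_unfold)
  let ?t = "\<lambda>n. t0 + real n"
  let ?V = "\<lambda>n. contour_integral (linepath (Complex (- ?t n) (Im b)) (Complex (- ?t n) (Im a))) f"
  have t_lim: "filterlim ?t at_top sequentially" by real_asymp
  have "(\<lambda>n. 1 / (2 * of_real pi * \<i>) * (?A (?t n) + contour_integral g f + ?B (?t n) + ?V n))
      \<longlonglongrightarrow> 1 / (2 * of_real pi * \<i>) * (LA + contour_integral g f + - LB + 0)"
  proof (intro tendsto_mult tendsto_add tendsto_const filterlim_compose[OF LA t_lim]
      filterlim_compose[OF LB' t_lim])
    have "\<bar>Im a - Im b\<bar> \<le> \<bar>Im a - Im b\<bar> * (1 + real n)" for n
      by (simp add: algebra_simps)
    then show "?V \<longlonglongrightarrow> 0"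
      by (rule contour_integral_left_edge_tendsto_0)
  qed
  moreover have "\<forall>\<^sub>F n in sequentially.
      1 / (2 * of_real pi * \<i>) * (?A (?t n) + contour_integral g f + ?B (?t n) + ?V n) = residue_sum n"
  proof -
    \<comment> \<open>From then on the cut lies to the left of \<open>g\<close> or touches it, since
      \<open>g\<close> stays in the disc of radius \<open>K\<close>.\<close>
    have "\<forall>\<^sub>F n in sequentially. K \<le> ?t n"
      using t_lim by (simp add: filterlim_at_top)
    then show ?thesis
    proof eventually_elim
      case (elim n)
      have left: "- ?t n \<le> Re s" if "s \<in> path_image g" for s
        using K[OF that] elim abs_Re_le_cmod[of s] by linarith
      then have ab: "- ?t n \<le> Re a" "- ?t n \<le> Re b"
        by (auto simp: a_def b_def)
      have img_left: "path_image (closed_loop g (?t n)) \<subseteq> {s. - ?t n \<le> Re s}"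
        using left ab unfolding path_image_closed_loop[OF g]
        by (auto simp: closed_segment_same_Im closed_segment_same_Re closed_segment_eq_real_ivl
          a_def b_def split: if_splits)
      have img: "path_image (closed_loop g (?t n)) \<subseteq> {s. - ?t n \<le> Re s} - P"
      proof
        fix s assume s: "s \<in> path_image (closed_loop g (?t n))"
        have "- ?t n \<le> Re s" using img_left s by auto
        \<comment> \<open>Points on the cut avoid the poles by the choice of \<open>t0\<close>; a
          pole strictly right of the cut is avoided because the loop has an index there.\<close>
        moreover have "s \<notin> P"
        proof (cases "Re s = - ?t n")
          case True
          then show ?thesis by (intro notin_P) blast
        next
          case False
          then show ?thesis using avoid[of s "?t n"] ab s calculation by auto
        qed
        ultimately show "s \<in> {s. - ?t n \<le> Re s} - P" by simp
      qed
      have V: "f contour_integrable_on linepath (Complex (- ?t n) (Im b)) (Complex (- ?t n) (Im a))"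
        using notin_P by (intro integrable_linepath) (auto simp: closed_segment_same_Re)
      have "contour_integral (closed_loop g (?t n)) f =
          ?A (?t n) + contour_integral g f + ?B (?t n) + ?V n"
        using contour_integral_closed_loop[OF g trunc(1)] V by (simp add: trunc(2) a_def b_def)
      moreover have "contour_integral (closed_loop g (?t n)) f = 2 * of_real pi * \<i> * residue_sum n"
        unfolding residue_sum_def
      proof (rule closed_curve_residues[OF holo P_fin])
        show "Re p \<noteq> - ?t n" if "p \<in> P" for p using notin_P[of p n] that by blast
      qed (use img avoid ab g in \<open>auto simp: valid_path_loops\<close>)
      ultimately have eq: "?A (?t n) + contour_integral g f + ?B (?t n) + ?V n =
          2 * of_real pi * \<i> * residue_sum n" by simp
      show ?case unfolding eq by simp
    qed
  qed
  ultimately have "residue_sum \<longlonglongrightarrow> 1 / (2 * of_real pi * \<i>) * (LA + contour_integral g f + - LB + 0)"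
    by (rule Lim_transform_eventually)
  then have "L = L'"
    using lim LIMSEQ_unique unfolding L'_def by (simp add: LIMSEQ_unique)
  with main show ?thesis by simp
qed

end

subsection \<open>Products of Gamma functions\<close>

text \<open>The list \<open>[0]\<close> gives the Cahen-Mellin integrand and
  \<open>[0, 1 / 2, 1 + \<nu>]\<close> the Meijer integrand, so both are handled by one decay
  argument. Poles of different factors may coincide; \<open>gamma_poles\<close> ignores
  multiplicity, and residues are evaluated only for \<open>[0]\<close>.\<close>

definition gamma_product :: "real list \<Rightarrow> real \<Rightarrow> complex \<Rightarrow> complex" where
  "gamma_product B x s = (\<Prod>b\<leftarrow>B. Gamma (of_real b + s)) * of_real x powr (- s)"

definition gamma_poles :: "real list \<Rightarrow> complex set" where
  "gamma_poles B = {- of_real (b + real k) | b k. b \<in> set B}"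

lemma gamma_poles_Cons: "gamma_poles (b # B) = {- of_real (b + real k) | k. True} \<union> gamma_poles B"
  by (auto simp: gamma_poles_def)

lemma holomorphic_gamma_product:
  assumes "x > 0"
  shows "gamma_product B x holomorphic_on - gamma_poles B"
proof -
  have "(\<lambda>s. \<Prod>b\<leftarrow>B. Gamma (of_real b + s)) holomorphic_on - gamma_poles B"
  proof (induction B)
    case (Cons b B)
    have "(\<lambda>s. Gamma (of_real b + s)) holomorphic_on - gamma_poles (b # B)"
    proof (intro holomorphic_intros)
      fix s assume s: "s \<in> - gamma_poles (b # B)"
      show "of_real b + s \<notin> \<int>\<^sub>\<le>\<^sub>0"
      proof
        assume "of_real b + s \<in> \<int>\<^sub>\<le>\<^sub>0"
        then obtain k where "of_real b + s = - of_nat k" by (elim nonpos_Ints_cases')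
        then have "s = - of_real (b + real k)" by (simp add: algebra_simps eq_neg_iff_add_eq_0)
        then show False using s by (auto simp: gamma_poles_Cons)
      qed
    qed
    moreover have "(\<lambda>s. \<Prod>b\<leftarrow>B. Gamma (of_real b + s)) holomorphic_on - gamma_poles (b # B)"
      by (rule holomorphic_on_subset[OF Cons.IH]) (auto simp: gamma_poles_Cons)
    ultimately show ?case by (auto intro: holomorphic_intros)
  qed simp
  then show ?thesis
    unfolding gamma_product_def[abs_def] using assms by (auto intro!: holomorphic_intros)
qed

lemma gamma_poles_distance:
  assumes "\<forall>p\<in>gamma_poles (b # B). d \<le> cmod (s - p)"
  shows "d \<le> cmod (of_real b + s + of_nat k)" "\<forall>p\<in>gamma_poles B. d \<le> cmod (s - p)"
proof -
  have "d \<le> cmod (s - (- of_real (b + real k)))"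
    using assms by (auto simp: gamma_poles_Cons)
  then show "d \<le> cmod (of_real b + s + of_nat k)" by (simp add: algebra_simps)
  show "\<forall>p\<in>gamma_poles B. d \<le> cmod (s - p)" using assms by (auto simp: gamma_poles_Cons)
qed

text \<open>One Gamma factor will provide all the decay; of the others only boundedness is required,
  which is \<open>Gamma_left_bound\<close> with \<open>M = 1\<close>.\<close>

lemma prod_Gamma_bounded:
  assumes "0 < d"
  obtains C where "C \<ge> 0"
    "\<And>s. Re s \<le> c \<Longrightarrow> \<forall>p\<in>gamma_poles B. d \<le> cmod (s - p) \<Longrightarrow>
      cmod (\<Prod>b\<leftarrow>B. Gamma (of_real b + s)) \<le> C"
proof -
  have "\<exists>C\<ge>0. \<forall>s. Re s \<le> c \<longrightarrow> (\<forall>p\<in>gamma_poles B. d \<le> cmod (s - p)) \<longrightarrow>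
      cmod (\<Prod>b\<leftarrow>B. Gamma (of_real b + s)) \<le> C"
  proof (induction B)
    case Nil
    show ?case by (auto intro!: exI[of _ 1])
  next
    case (Cons b B)
    then obtain C where C: "C \<ge> 0" "\<And>s. Re s \<le> c \<Longrightarrow> \<forall>p\<in>gamma_poles B. d \<le> cmod (s - p) \<Longrightarrow>
      cmod (\<Prod>b\<leftarrow>B. Gamma (of_real b + s)) \<le> C" by blast
    obtain D where D: "D \<ge> 0" "\<And>s. Re s \<le> b + c \<Longrightarrow> (\<And>k. d \<le> cmod (s + of_nat k)) \<Longrightarrow>
       cmod (Gamma s) * (1 + \<bar>Im s\<bar>)\<^sup>2 \<le> D * 1 powr Re s"
      by (rule Gamma_left_bound[OF assms, of 1 "b + c"]) auto
    have "cmod (\<Prod>b\<leftarrow>b # B. Gamma (of_real b + s)) \<le> D * C"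
      if s: "Re s \<le> c" "\<forall>p\<in>gamma_poles (b # B). d \<le> cmod (s - p)" for s
    proof -
      have "cmod (Gamma (of_real b + s)) * 1 \<le> cmod (Gamma (of_real b + s)) * (1 + \<bar>Im s\<bar>)\<^sup>2"
        by (intro mult_left_mono) (auto intro: one_le_power)
      also have "\<dots> \<le> D"
        using D(2)[of "of_real b + s"] s gamma_poles_distance[OF s(2)] by simp
      finally show ?thesis
        using C(2)[OF s(1)] gamma_poles_distance(2)[OF s(2)] D(1)
        by (simp add: norm_mult mult_mono)
    qed
    then show ?case using C(1) D(1) by (intro exI[of _ "D * C"]) simp
  qed
  then show ?thesis using that by blast
qed

text \<open>The first factor yields both the exponential and the quadratic decay, while the
  remaining factors stay bounded away from the poles.\<close>

lemma left_decaying_gamma_product: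
  assumes x: "x > 0" and B: "B \<noteq> []" "\<And>b. b \<in> set B \<Longrightarrow> b \<ge> 0"
    and t0: "0 < t0" "0 < \<delta>"
    and gap: "\<And>b k n. b \<in> set B \<Longrightarrow> \<delta> \<le> \<bar>t0 + real n - (b + real k)\<bar>"
  shows "left_decaying (gamma_product B x) (gamma_poles B) t0 \<delta>"
proof
  show "gamma_product B x holomorphic_on - gamma_poles B"
    by (rule holomorphic_gamma_product[OF x])
  show "Im p = 0" "Re p \<le> 0" if pole: "p \<in> gamma_poles B" for p
  proof -
    obtain b k where p: "p = - of_real (b + real k)" "b \<in> set B"
      using pole by (auto simp: gamma_poles_def)
    then show "Im p = 0" "Re p \<le> 0" using B(2)[OF p(2)] by auto
  qed
  show "finite {p \<in> gamma_poles B. b < Re p}" for b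
  proof (rule finite_subset)
    show "{p \<in> gamma_poles B. b < Re p} \<subseteq>
        (\<lambda>(a, k). - of_real (a + real k)) ` (set B \<times> {..nat \<lceil>- b\<rceil>})"
    proof
      fix p assume "p \<in> {p \<in> gamma_poles B. b < Re p}"
      then obtain a k where p: "p = - of_real (a + real k)" "a \<in> set B" "b < - (a + real k)"
        by (auto simp: gamma_poles_def)
      then have "k \<le> nat \<lceil>- b\<rceil>" using B(2)[of a] by linarith
      then show "p \<in> (\<lambda>(a, k). - of_real (a + real k)) ` (set B \<times> {..nat \<lceil>- b\<rceil>})"
        using p by (auto intro!: image_eqI[of _ _ "(a, k)"])
    qed
  qed auto
  show "\<delta> \<le> \<bar>Re p + (t0 + real n)\<bar>" if p: "p \<in> gamma_poles B" for p n
  proof -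
    obtain b k where "p = - of_real (b + real k)" "b \<in> set B" using p by (auto simp: gamma_poles_def)
    moreover from this have "Re p + (t0 + real n) = t0 + real n - (b + real k)" by simp
    ultimately show ?thesis using gap[of b n k] by simp
  qed
  fix d c :: real assume d: "0 < d"
  obtain b B' where BB: "B = b # B'" using B(1) by (cases B) auto
  obtain C where C: "C \<ge> 0" "\<And>s. Re s \<le> c \<Longrightarrow> \<forall>p\<in>gamma_poles B'. d \<le> cmod (s - p) \<Longrightarrow>
      cmod (\<Prod>b\<leftarrow>B'. Gamma (of_real b + s)) \<le> C"
    by (rule prod_Gamma_bounded[OF d, of c B']) blast
  \<comment> \<open>With this \<open>M\<close> the growth of \<open>x powr (- Re s)\<close> to the
    left is absorbed and exactly \<open>exp (Re s)\<close> remains.\<close>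
  define M where "M = exp 1 * x"
  have M: "M > 0" using x by (simp add: M_def)
  obtain D where D: "D \<ge> 0" "\<And>s. Re s \<le> b + c \<Longrightarrow> (\<And>k. d \<le> cmod (s + of_nat k)) \<Longrightarrow>
      cmod (Gamma s) * (1 + \<bar>Im s\<bar>)\<^sup>2 \<le> D * M powr Re s"
    by (rule Gamma_left_bound[OF d M, of "b + c"]) blast
  have "cmod (gamma_product B x s) \<le> D * M powr b * C * exp (Re s) / (1 + \<bar>Im s\<bar>)\<^sup>2"
    if s: "Re s \<le> c" "\<forall>p\<in>gamma_poles B. d \<le> cmod (s - p)" for s
  proof -
    have 1: "cmod (Gamma (of_real b + s)) * (1 + \<bar>Im s\<bar>)\<^sup>2 \<le> D * M powr (b + Re s)"
      using D(2)[of "of_real b + s"] s gamma_poles_distance[OF s(2)[unfolded BB]] by simp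
    have 2: "cmod (\<Prod>b\<leftarrow>B'. Gamma (of_real b + s)) \<le> C"
      using C(2)[OF s(1)] gamma_poles_distance(2)[OF s(2)[unfolded BB]] by simp
    have 3: "cmod (of_real x powr (- s)) = x powr (- Re s)"
      using x by (simp add: norm_powr_real_powr)
    have 4: "M powr (b + Re s) * x powr (- Re s) = M powr b * exp (Re s)"
      using x by (simp add: M_def powr_add powr_mult powr_minus exp_powr_real field_simps)
    have "cmod (gamma_product B x s) * (1 + \<bar>Im s\<bar>)\<^sup>2 =
        (cmod (Gamma (of_real b + s)) * (1 + \<bar>Im s\<bar>)\<^sup>2) *
        cmod (\<Prod>b\<leftarrow>B'. Gamma (of_real b + s)) * x powr (- Re s)"
      by (simp add: gamma_product_def BB norm_mult 3)
    also have "\<dots> \<le> (D * M powr (b + Re s)) * C * x powr (- Re s)"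
      using D(1) C(1) by (intro mult_right_mono mult_mono[OF 1 2]) auto
    also have "\<dots> = D * C * (M powr (b + Re s) * x powr (- Re s))"
      by (simp only: mult_ac)
    also have "\<dots> = D * M powr b * C * exp (Re s)"
      unfolding 4 by (simp only: mult_ac)
    finally have "cmod (gamma_product B x s) * (1 + \<bar>Im s\<bar>)\<^sup>2 \<le> D * M powr b * C * exp (Re s)" .
    moreover have "0 < (1 + \<bar>Im s\<bar>)\<^sup>2" by (simp add: add_pos_nonneg)
    ultimately show ?thesis by (simp only: pos_le_divide_eq)
  qed
  then show "\<exists>C\<ge>0. \<forall>s. Re s \<le> c \<longrightarrow> (\<forall>p\<in>gamma_poles B. d \<le> cmod (s - p)) \<longrightarrow>
      cmod (gamma_product B x s) \<le> C * exp (Re s) / (1 + \<bar>Im s\<bar>)\<^sup>2"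
    using C(1) D(1) by (intro exI[of _ "D * M powr b * C"]) simp
qed (use t0 in auto)

text \<open>The translates of the integers by entries of \<open>B\<close> form a countable set, so
  some \<open>t0\<close> in \<open>(0, 1)\<close> avoids it. The set is closed, hence
  \<open>t0\<close> has positive distance from it; the distance is uniform in \<open>k\<close> and
  \<open>n\<close> because only \<open>k - n\<close> matters.\<close>

lemma exists_gap:
  fixes B :: "real list"
  obtains t0 \<delta> :: real where "0 < t0" "0 < \<delta>"
    "\<And>b k n. b \<in> set B \<Longrightarrow> \<delta> \<le> \<bar>t0 + real n - (b + real k)\<bar>"
proof -
  let ?bad = "\<Union>b\<in>set B. (\<lambda>i. b + real_of_int i) ` UNIV"
  have "countable ?bad" by (intro countable_UN countable_image) (auto intro: countable_finite)
  moreover have "uncountable {0<..<1::real}" by (simp add: uncountable_open_interval)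
  ultimately have "\<not> {0<..<1} \<subseteq> ?bad" using countable_subset by blast
  then obtain t0 where "t0 \<in> {0<..<1}" and bad: "t0 \<notin> ?bad" by blast
  then have t0: "0 < t0" by simp
  have cl: "closed (\<Union>b\<in>set B. (\<lambda>i. b + i) ` (\<int> :: real set))"
    by (intro closed_UN ballI finite_set closed_translation closed_Ints)
  have notin: "t0 \<notin> (\<Union>b\<in>set B. (\<lambda>i. b + i) ` \<int>)"
    using bad by (auto elim!: Ints_cases)
  from separate_point_closed[OF cl notin]
  obtain \<delta> where \<delta>: "0 < \<delta>" "\<And>y. y \<in> (\<Union>b\<in>set B. (\<lambda>i. b + i) ` \<int>) \<Longrightarrow> \<delta> \<le> dist t0 y"
    by (elim exE conjE) (rule that, auto)
  show ?thesis
  proof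
    fix b k n assume "b \<in> set B"
    then have "b + (real k - real n) \<in> (\<Union>b\<in>set B. (\<lambda>i. b + i) ` \<int>)"
      by (intro UN_I imageI) auto
    from \<delta>(2)[OF this] show "\<delta> \<le> \<bar>t0 + real n - (b + real k)\<bar>"
      by (simp add: dist_real_def algebra_simps)
  qed (use t0 \<delta> in auto)
qed

section \<open>The Cahen-Mellin integral\<close>

lemma gamma_product_single:
  "gamma_product [0] x s = Gamma s * of_real x powr (- s)" "gamma_poles [0] = range (\<lambda>k. - of_nat k)"
  by (auto simp: gamma_product_def gamma_poles_def)

text \<open>The pole is simple, so the residue is that of Gamma times the value of the power. These
  are the terms of the series of \<open>exp (- x)\<close>.\<close>

lemma residue_Gamma_powr:
  assumes "x > 0"
  shows "residue (gamma_product [0] x) (- of_nat k) = (- of_real x) ^ k / fact k"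
proof (rule residue_simple')
  \<comment> \<open>The neighbourhood is the complement of all the other poles, open because every
    set of integers is closed.\<close>
  show "open (- (\<int>\<^sub>\<le>\<^sub>0 - {- of_nat k}) :: complex set)"
    by (intro open_Compl closed_subset_Ints) auto
  show "gamma_product [0] x holomorphic_on (- (\<int>\<^sub>\<le>\<^sub>0 - {- of_nat k}) - {- of_nat k})"
    by (rule holomorphic_on_subset[OF holomorphic_gamma_product[OF assms]])
       (auto simp: gamma_product_single)
  have "(\<lambda>w. complex_of_real x powr (- w)) \<midarrow>- of_nat k\<rightarrow> of_real x powr (- (- of_nat k))"
    using assms unfolding powr_def by (auto intro!: tendsto_eq_intros)
  moreover have "(\<lambda>w. Gamma w * (w - (- of_nat k)) :: complex) \<midarrow>- of_nat k\<rightarrow> (- 1) ^ k / fact k"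
    using Gamma_residues[of k, where 'a = complex] by simp
  ultimately have "(\<lambda>w::complex. Gamma w * (w - (- of_nat k)) * of_real x powr (- w))
      \<midarrow>- of_nat k\<rightarrow> (- 1) ^ k / fact k * of_real x powr (- (- of_nat k))"
    by (intro tendsto_mult)
  also have "(- 1) ^ k / fact k * complex_of_real x powr (- (- of_nat k)) = (- of_real x) ^ k / fact k"
    using assms by (simp add: powr_nat' power_minus[of "of_real x"])
  finally show "(\<lambda>w. gamma_product [0] x w * (w - (- of_nat k))) \<midarrow>- of_nat k\<rightarrow> (- of_real x) ^ k / fact k"
    by (simp add: gamma_product_single mult_ac)
qed auto

text \<open>The lines \<open>Re s = -(1/2 + n)\<close> run halfway between neighbouring
  poles.\<close>

lemma left_decaying_Gamma_powr:
  assumes "x > 0"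
  shows "left_decaying (gamma_product [0] x) (gamma_poles [0]) (1 / 2) (1 / 2)"
proof (rule left_decaying_gamma_product[OF assms])
  fix b :: real and k n :: nat assume "b \<in> set [0]"
  have "real n \<le> real k - 1 \<or> real k \<le> real n"
    using of_nat_mono[of "Suc n" k, where 'a = real] by (cases "n < k") auto
  then show "1 / 2 \<le> \<bar>1 / 2 + real n - (b + real k)\<bar>" using \<open>b \<in> set [0]\<close> by auto
qed auto

text \<open>The residue sums are the partial sums of the exponential series, and
  \<open>residue_sum_limit\<close> identifies their limit with the line integral.\<close>

lemma Cahen_Mellin:
  assumes "x > 0" "c > 0"
  shows "(LINT y|lborel. Gamma (Complex c y) * of_real x powr (- Complex c y)) = 2 * of_real pi * exp (- of_real x)"
proof -
  interpret left_decaying "gamma_product [0] x" "gamma_poles [0]" "1 / 2" "1 / 2"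
    by (rule left_decaying_Gamma_powr[OF assms(1)])
  have "residue_sum n = (\<Sum>k\<le>n. (- of_real x) ^ k / fact k)" for n
  proof -
    have "{p \<in> gamma_poles [0]. - (1 / 2 + real n) < Re p} = (\<lambda>k. - of_nat k) ` {..n}"
    proof -
      have "real k < 1 / 2 + real n \<longleftrightarrow> k \<le> n" for k
        using of_nat_mono[of "Suc n" k, where 'a = real] by (cases "k \<le> n") auto
      then show ?thesis by (auto simp: gamma_product_single)
    qed
    then show ?thesis
      unfolding residue_sum_def
      by (simp add: sum.reindex inj_on_def residue_Gamma_powr[OF assms(1)])
  qed
  then have "residue_sum = (\<lambda>n. \<Sum>k\<le>n. (- of_real x) ^ k / fact k)" by blast
  then have "(\<lambda>n. \<Sum>k\<le>n. (- of_real x) ^ k / fact k)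
      \<longlonglongrightarrow> (LINT y|lborel. gamma_product [0] x (Complex c y)) / (2 * of_real pi)"
    using residue_sum_limit[OF assms(2)] by simp
  moreover have "(\<lambda>n. \<Sum>k\<le>n. (- of_real x) ^ k / fact k) \<longlonglongrightarrow> exp (- complex_of_real x)"
    using exp_converges[of "- complex_of_real x"]
    by (simp add: sums_def_le scaleR_conv_of_real divide_inverse mult_ac)
  ultimately have "(LINT y|lborel. gamma_product [0] x (Complex c y)) / (2 * of_real pi) =
      exp (- complex_of_real x)"
    by (rule LIMSEQ_unique)
  then show ?thesis by (simp add: gamma_product_single field_simps)
qed

section \<open>Euler's integral and the exchange of integrations\<close>

lemma Gamma_set_lebesgue_integral:
  assumes "Re s > 0"
  shows "set_integrable lborel {0<..} (\<lambda>t. of_real t powr (s - 1) / of_real (exp t))"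
    "(LBINT t:{0<..}. of_real t powr (s - 1) / of_real (exp t)) = Gamma s"
proof -
  let ?f = "\<lambda>t::real. complex_of_real t powr (s - 1) / of_real (exp t)"
  \<comment> \<open>Absolute gauge integrability is integrability for the completed measure; Borel
    measurability brings it down to \<open>lborel\<close>, where Fubini's theorem will be
    applied.\<close>
  have "(\<lambda>t. indicat_real {0<..} t *\<^sub>R ?f t) \<in> borel_measurable borel"
    unfolding powr_def by measurable
  then show int: "set_integrable lborel {0<..} ?f"
    using absolutely_integrable_Gamma_integral'[OF assms]
    unfolding set_integrable_def by (subst (asm) integrable_completion) auto
  show "(LBINT t:{0<..}. ?f t) = Gamma s"
    using set_borel_integral_eq_integral(2)[OF int] Gamma_integral_complex'[OF assms]
    by (simp add: integral_unique)
qed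

text \<open>With Euler's integral inserted, \<open>t powr s * z powr (-2 s)\<close> is
  \<open>w powr (-2 s)\<close> for \<open>w = z / sqrt t\<close>. The integral over \<open>y\<close>
  is then of Cahen-Mellin type on \<open>Re u = 2\<close> with \<open>u = 2 s\<close>, and its value
  supplies the factor \<open>exp (-z / sqrt t)\<close> of \<open>I1\<close>.\<close>

lemma Mellin_Barnes_integral:
  fixes z \<nu> :: real
  assumes "z > 0" "\<nu> \<ge> 0"
  shows "(LINT y|lborel. Gamma (2 * Complex 1 y) * Gamma (1 + of_real \<nu> + Complex 1 y) *
      of_real z powr (- 2 * Complex 1 y)) = of_real pi * of_real (I1 z \<nu>)"
proof -
  let ?s = "\<lambda>y. Complex 1 y"
  have s: "?s y = 1 + \<i> * of_real y" for y by (simp add: complex_eq_iff)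
  let ?G = "\<lambda>y. Gamma (2 * ?s y)"
  have G_cont: "continuous_on UNIV ?G"
  proof (rule continuous_on_compose2[OF continuous_on_Gamma])
    show "{w. Re w > 0} \<inter> \<int>\<^sub>\<le>\<^sub>0 = {}" by (auto elim!: nonpos_Ints_cases')
    show "continuous_on UNIV (\<lambda>y. 2 * ?s y)" unfolding s by (intro continuous_intros)
  qed auto
  have [measurable]: "(\<lambda>y. Gamma (2 * (1 + \<i> * of_real y))) \<in> borel_measurable borel"
    by (rule borel_measurable_continuous_onI[OF G_cont[unfolded s]])
  \<comment> \<open>Exponentials of real logarithms replace the powers here to make joint
    measurability evident.\<close>
  define g where "g = (\<lambda>t y. indicat_real {0<..} t *\<^sub>R
      (?G y * (exp ((of_real \<nu> + ?s y) * of_real (ln t)) / of_real (exp t)) * exp (- 2 * ?s y * of_real (ln z))))"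
  have g_meas: "case_prod g \<in> borel_measurable (lborel \<Otimes>\<^sub>M lborel)"
    unfolding g_def s by measurable
  have g_powr: "g t y = ?G y * of_real z powr (- 2 * ?s y) *
      (indicat_real {0<..} t *\<^sub>R (of_real t powr ((1 + of_real \<nu> + ?s y) - 1) / of_real (exp t)))" for t y
    using assms by (auto simp: g_def indicator_def powr_def Ln_of_real)
  have g_inner: "(LINT t|lborel. g t y) =
      ?G y * Gamma (1 + of_real \<nu> + ?s y) * of_real z powr (- 2 * ?s y)" for y
  proof -
    have "(LINT t|lborel. g t y) = ?G y * of_real z powr (- 2 * ?s y) *
      (LBINT t:{0<..}. of_real t powr ((1 + of_real \<nu> + ?s y) - 1) / of_real (exp t))"
      unfolding g_powr set_lebesgue_integral_def by (rule integral_mult_right_zero)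
    also have "(LBINT t:{0<..}. of_real t powr ((1 + of_real \<nu> + ?s y) - 1) / of_real (exp t)) =
        Gamma (1 + of_real \<nu> + ?s y)"
      using assms by (intro Gamma_set_lebesgue_integral) simp
    finally show ?thesis by (simp only: mult_ac)
  qed
  \<comment> \<open>On \<open>Re s = 1\<close> the norm splits into a function of \<open>y\<close>
    times a function of \<open>t\<close>, so Fubini's hypothesis reduces to integrability of
    each.\<close>
  have norm_g: "norm (g t y) = norm (?G y) * z powr (- 2) *
      (indicat_real {0<..} t *\<^sub>R (t powr (1 + \<nu>) / exp t))" for t y
  proof -
    have "norm (g t y) = norm (?G y) * norm (complex_of_real z powr (- 2 * ?s y)) *
      (indicat_real {0<..} t * (norm (complex_of_real t powr ((1 + of_real \<nu> + ?s y) - 1)) / exp t))"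
      unfolding g_powr norm_mult norm_scaleR norm_divide by simp
    also have "norm (complex_of_real z powr (- 2 * ?s y)) = z powr (- 2)"
      using assms by (simp add: norm_powr_real_powr)
    also have "indicat_real {0<..} t * (norm (complex_of_real t powr ((1 + of_real \<nu> + ?s y) - 1)) / exp t)
        = indicat_real {0<..} t *\<^sub>R (t powr (1 + \<nu>) / exp t)"
      by (auto simp: indicator_def norm_powr_real_powr add.commute)
    finally show ?thesis .
  qed
  have t_int: "integrable lborel (\<lambda>t. indicat_real {0<..} t *\<^sub>R (t powr (1 + \<nu>) / exp t))"
  proof -
    have "set_integrable lborel {0<..}
        (\<lambda>t. of_real t powr (complex_of_real (2 + \<nu>) - 1) / of_real (exp t))"
      using assms by (intro Gamma_set_lebesgue_integral) simp
    then have "integrable lborel (\<lambda>t. norm (indicat_real {0<..} t *\<^sub>R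
        (of_real t powr (complex_of_real (2 + \<nu>) - 1) / of_real (exp t))))"
      unfolding set_integrable_def by (rule integrable_norm)
    also have "(\<lambda>t. norm (indicat_real {0<..} t *\<^sub>R
        (of_real t powr (complex_of_real (2 + \<nu>) - 1) / of_real (exp t)))) =
        (\<lambda>t. indicat_real {0<..} t *\<^sub>R (t powr (1 + \<nu>) / exp t))"
      by (intro ext) (auto simp: indicator_def norm_powr_real_powr norm_divide add.commute)
    finally show ?thesis .
  qed
  \<comment> \<open>For \<open>x = 1\<close> the power is 1, which leaves integrability of Gamma
    itself on the line \<open>Re u = 2\<close>.\<close>
  interpret ld: left_decaying "gamma_product [0] 1" "gamma_poles [0]" "1 / 2" "1 / 2"
    by (rule left_decaying_Gamma_powr) simp
  \<comment> \<open>The shape \<open>0 + 2 * y\<close> fits the affine substitution rule for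
    \<open>lborel\<close>.\<close>
  have double: "Complex 2 (0 + 2 * y) = 2 * ?s y" for y by (simp add: complex_eq_iff)
  have G_int: "integrable lborel ?G"
  proof -
    have "integrable lborel (\<lambda>y. Gamma (Complex 2 y))"
      using ld.integrable_vertical_line[of 2] by (simp add: gamma_product_single)
    from lborel_integrable_real_affine[OF this, of 2 0] show ?thesis
      unfolding double by simp
  qed
  have "integrable (lborel \<Otimes>\<^sub>M lborel) (case_prod g)"
  proof (rule lborel_pair.Fubini_integrable[OF g_meas])
    show "integrable lborel (\<lambda>t. LINT y|lborel. norm (case_prod g (t, y)))"
      unfolding prod.case norm_g integral_mult_left_zero by (intro integrable_mult_right t_int)
    have "integrable lborel (\<lambda>y. g t y)" for t
    proof (rule Bochner_Integration.integrable_bound)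
      show "integrable lborel (\<lambda>y. norm (?G y) * z powr (- 2) *
          (indicat_real {0<..} t *\<^sub>R (t powr (1 + \<nu>) / exp t)))"
        using G_int by (intro integrable_mult_left integrable_norm)
      show "g t \<in> borel_measurable lborel"
        unfolding g_def s by measurable
    qed (simp add: norm_g)
    then show "AE t in lborel. integrable lborel (\<lambda>y. case_prod g (t, y))" by simp
  qed
  then have swap: "(LINT y|lborel. LINT t|lborel. g t y) = (LINT t|lborel. LINT y|lborel. g t y)"
    by (rule lborel_pair.Fubini_integral)
  have outer: "(LINT y|lborel. g t y) = of_real (pi * (indicat_real {0<..} t *\<^sub>R
      (t powr \<nu> * exp (- t) * exp (- z * t powr (- 1 / 2)))))" for t
  proof (cases "t > 0")
    case True
    define w where "w = z * t powr (- 1 / 2)"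
    have w: "w > 0" "ln w = ln z - ln t / 2"
      using True assms by (simp_all add: w_def ln_mult ln_powr)
    have g_eq: "g t y = of_real (t powr \<nu> * exp (- t)) *
        (Gamma (Complex 2 (0 + 2 * y)) * of_real w powr (- Complex 2 (0 + 2 * y)))" for y
    proof -
      have "exp ((of_real \<nu> + ?s y) * of_real (ln t)) * exp (- 2 * ?s y * of_real (ln z)) =
          exp (of_real (\<nu> * ln t)) * exp (- (2 * ?s y) * of_real (ln w))"
        unfolding exp_add[symmetric] w by (simp add: algebra_simps)
      also have "exp (- (2 * ?s y) * of_real (ln w)) = of_real w powr (- (2 * ?s y))"
        using w by (simp add: powr_def Ln_of_real)
      also have "exp (of_real (\<nu> * ln t)) = complex_of_real (t powr \<nu>)"
        unfolding exp_of_real using True by (simp add: powr_def)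
      finally have "exp ((of_real \<nu> + ?s y) * of_real (ln t)) * exp (- 2 * ?s y * of_real (ln z)) =
        of_real (t powr \<nu>) * of_real w powr (- (2 * ?s y))" .
      then have "?G y * (exp ((of_real \<nu> + ?s y) * of_real (ln t)) * exp (- 2 * ?s y * of_real (ln z))) / of_real (exp t)
        = ?G y * (of_real (t powr \<nu>) * of_real w powr (- (2 * ?s y))) / of_real (exp t)" by simp
      then show ?thesis
        using True unfolding double by (simp add: g_def exp_minus divide_inverse mult_ac)
    qed
    have "(LINT y|lborel. g t y) = of_real (t powr \<nu> * exp (- t)) *
        (LINT y|lborel. Gamma (Complex 2 (0 + 2 * y)) * of_real w powr (- Complex 2 (0 + 2 * y)))"
      unfolding g_eq by (rule integral_mult_right_zero)
    \<comment> \<open>The substitution contributes the factor 1/2, which turns the Cahen-Mellin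
      value \<open>2 \<pi> exp (-w)\<close> into \<open>\<pi> exp (-w)\<close>.\<close>
    also have "(LINT y|lborel. Gamma (Complex 2 (0 + 2 * y)) * of_real w powr (- Complex 2 (0 + 2 * y))) =
        (LINT y|lborel. Gamma (Complex 2 y) * of_real w powr (- Complex 2 y)) / 2"
      using lborel_integral_real_affine[of 2 "\<lambda>y. Gamma (Complex 2 y) * of_real w powr (- Complex 2 y)" 0]
      by (simp add: scaleR_conv_of_real)
    also have "\<dots> = of_real (pi * exp (- w))"
      using Cahen_Mellin[OF w(1), of 2] by (simp add: exp_of_real[symmetric])
    finally show ?thesis
      using True by (simp add: w_def mult_ac)
  qed (simp add: g_def)
  have "(LINT y|lborel. ?G y * Gamma (1 + of_real \<nu> + ?s y) * of_real z powr (- 2 * ?s y)) =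
      (LINT t|lborel. complex_of_real (pi * (indicat_real {0<..} t *\<^sub>R
      (t powr \<nu> * exp (- t) * exp (- z * t powr (- 1 / 2))))))"
    using swap unfolding g_inner outer .
  also have "\<dots> = of_real (pi * I1 z \<nu>)"
    unfolding I1_def set_lebesgue_integral_def
    by (simp only: integral_complex_of_real integral_mult_right_zero)
  finally show ?thesis by simp
qed

subsection \<open>The Meijer function\<close>

lemma gamma_poles_eq_UN: "gamma_poles B = (\<Union>b\<in>set B. gamma_poles [b])"
  by (auto simp: gamma_poles_def)

text \<open>Translates the pole condition of \<open>meijer_loop\<close> into the explicit set used
  in the residue argument. Away from nonpositive integers Gamma has a finite limit, which excludes a
  pole.\<close>

lemma is_pole_Gamma_shift_iff:
  "is_pole (\<lambda>s. Gamma (of_real b + s)) w \<longleftrightarrow> w \<in> gamma_poles [b]"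
proof
  assume pole: "is_pole (\<lambda>s. Gamma (of_real b + s)) w"
  have "of_real b + w \<in> \<int>\<^sub>\<le>\<^sub>0"
  proof (rule ccontr)
    assume "of_real b + w \<notin> \<int>\<^sub>\<le>\<^sub>0"
    then have "((\<lambda>s. Gamma (of_real b + s)) \<longlongrightarrow> Gamma (of_real b + w)) (at w)"
      by (intro tendsto_intros)
    then show False
      using pole not_tendsto_and_filterlim_at_infinity[of "at w"] unfolding is_pole_def by auto
  qed
  then obtain k where "of_real b + w = - of_nat k" by (elim nonpos_Ints_cases')
  then have "w = - of_real (b + real k)" by (simp add: algebra_simps eq_neg_iff_add_eq_0)
  then show "w \<in> gamma_poles [b]" by (auto simp: gamma_poles_def)
next
  assume "w \<in> gamma_poles [b]"
  then obtain k where w: "w = - of_real (b + real k)" by (auto simp: gamma_poles_def)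
  have "filterlim (\<lambda>s. of_real b + s) (at (- of_nat k)) (at w)"
  proof (rule filterlim_atI)
    show "((\<lambda>s. of_real b + s) \<longlongrightarrow> - of_nat k) (at w)"
      by (auto intro!: tendsto_eq_intros simp: w)
    show "\<forall>\<^sub>F s in at w. of_real b + s \<noteq> - of_nat k"
      unfolding eventually_at_topological by (auto simp: w algebra_simps eq_neg_iff_add_eq_0)
  qed
  from filterlim_compose[OF Gamma_poles this] show "is_pole (\<lambda>s. Gamma (of_real b + s)) w"
    by (simp add: is_pole_def)
qed

text \<open>Supplies an admissible loop. Its closure has the edges of a rectangle but joins them
  with different bracketing, so winding numbers are compared through integrals of
  \<open>1 / (s - p)\<close>, not through equality of paths.\<close>

lemma loop_index_vertical_segment:
  assumes "Im p = 0" "Re p < 1"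
  shows "loop_index (linepath (Complex 1 (- 1)) (Complex 1 1)) p 1"
proof -
  let ?g = "linepath (Complex 1 (- 1)) (Complex 1 1)"
  let ?f = "\<lambda>s. 1 / (s - p)"
  have "p \<notin> path_image (closed_loop ?g T) \<and> winding_number (closed_loop ?g T) p = 1"
    if T: "- Re p < T" "0 < T" for T
  proof -
    let ?r = "rectpath (Complex (- T) (- 1)) (Complex 1 1)"
    have img: "path_image (closed_loop ?g T) = path_image ?r"
      by (auto simp: path_image_closed_loop rectpath_def Let_def path_image_join)
    have notin: "p \<notin> path_image ?r"
      using T assms by (subst path_image_rectpath) auto
    have int: "?f contour_integrable_on linepath (Complex (- T) (- 1)) (Complex 1 (- 1))"
      "?f contour_integrable_on ?g"
      "?f contour_integrable_on linepath (Complex 1 1) (Complex (- T) 1)"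
      "?f contour_integrable_on linepath (Complex (- T) 1) (Complex (- T) (- 1))"
      by (rule contour_integrable_inversediff, simp,
        use notin in \<open>simp add: rectpath_def Let_def path_image_join\<close>)+
    have "contour_integral (closed_loop ?g T) ?f = contour_integral ?r ?f"
      using contour_integral_trunc_loop[of ?g ?f T T] contour_integral_closed_loop[of ?g ?f T] int
      by (simp add: rectpath_def Let_def)
    then have "winding_number (closed_loop ?g T) p = winding_number ?r p"
      using notin by (simp add: winding_number_valid_path valid_path_loops img)
    also have "\<dots> = 1"
      using T assms by (intro winding_number_rectpath) (auto simp: in_box_complex_iff)
    finally show ?thesis using notin by (simp add: img)
  qed
  then show ?thesis
    unfolding loop_index_def
    by (intro eventually_mono[OF eventually_conj[OF eventually_gt_at_top[of "- Re p"]
      eventually_gt_at_top[of 0]]]) auto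
qed

text \<open>Legendre's formula for the parameters 0 and 1/2 produces
  \<open>2 powr (1 - 2 s)\<close>; its variable part cancels against \<open>4 powr s\<close> from
  the argument \<open>z^2 / 4\<close>.\<close>

lemma gamma_product_duplication:
  assumes "z > 0" "Re s > 0"
  shows "gamma_product [0, 1 / 2, 1 + \<nu>] (z\<^sup>2 / 4) s = 2 * of_real (sqrt pi) *
    (Gamma (2 * s) * Gamma (1 + of_real \<nu> + s) * of_real z powr (- 2 * s))"
proof -
  have s: "s \<notin> \<int>\<^sub>\<le>\<^sub>0" "s + 1 / 2 \<notin> \<int>\<^sub>\<le>\<^sub>0"
    using assms(2) by (auto elim!: nonpos_Ints_cases' simp: complex_eq_iff)
  have "ln (z\<^sup>2 / 4) = 2 * ln z - 2 * ln 2"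
    using assms(1) ln_realpow[of 2 2] by (simp add: ln_div ln_realpow)
  then have ln: "Ln (complex_of_real (z\<^sup>2 / 4)) = of_real (2 * ln z - 2 * ln 2)"
    using assms(1) by (subst Ln_of_real) auto
  have "exp ((1 - 2 * s) * of_real (ln 2)) * of_real (z\<^sup>2 / 4) powr (- s) =
      exp ((1 - 2 * s) * of_real (ln 2)) * exp (- s * of_real (2 * ln z - 2 * ln 2))"
    unfolding powr_def ln using assms(1) by simp
  also have "\<dots> = exp (of_real (ln 2) + - 2 * s * of_real (ln z))"
    unfolding exp_add[symmetric] by (simp add: algebra_simps)
  also have "\<dots> = 2 * of_real z powr (- 2 * s)"
    unfolding exp_add exp_of_real using assms(1) by (simp add: powr_def Ln_of_real)
  finally have "exp ((1 - 2 * s) * of_real (ln 2)) * of_real (z\<^sup>2 / 4) powr (- s) =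
      2 * of_real z powr (- 2 * s)" .
  moreover have "gamma_product [0, 1 / 2, 1 + \<nu>] (z\<^sup>2 / 4) s =
      (Gamma s * Gamma (s + 1 / 2)) * Gamma (1 + of_real \<nu> + s) * of_real (z\<^sup>2 / 4) powr (- s)"
    by (simp add: gamma_product_def add_ac mult_ac)
  ultimately show ?thesis
    unfolding Gamma_legendre_duplication[OF s] by (simp only: mult_ac)
qed

lemma meijer_integrand_eq_gamma_product:
  "meijer_integrand 3 0 [] [0, 1 / 2, 1 + of_real \<nu>] (of_real x) = gamma_product [0, 1 / 2, 1 + \<nu>] x"
  by (intro ext) (simp add: meijer_integrand_def gamma_product_def)

text \<open>Every admissible loop yields the limit of the residue sums, and so does the line
  \<open>Re s = 1\<close>. The constants combine to
  \<open>2 sqrt \<pi> * \<pi> / (2 \<pi>) = sqrt \<pi>\<close>.\<close>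

lemma has_meijer_G_Mellin_Barnes:
  assumes "z > 0" "\<nu> \<ge> 0"
  shows "has_meijer_G 3 0 [] [0, 1 / 2, 1 + of_real \<nu>] (of_real (z\<^sup>2 / 4))
    (of_real (sqrt pi) * of_real (I1 z \<nu>))"
proof -
  let ?B = "[0, 1 / 2, 1 + \<nu>]"
  let ?f = "gamma_product ?B (z\<^sup>2 / 4)"
  obtain t0 \<delta> where t0: "0 < t0" "0 < \<delta>"
    "\<And>b k n. b \<in> set ?B \<Longrightarrow> \<delta> \<le> \<bar>t0 + real n - (b + real k)\<bar>"
    using exists_gap[of ?B] by metis
  interpret left_decaying ?f "gamma_poles ?B" t0 \<delta>
    by (rule left_decaying_gamma_product) (use assms t0 in auto)
  have "(LINT y|lborel. ?f (Complex 1 y)) = 2 * of_real (sqrt pi) * (of_real pi * of_real (I1 z \<nu>))"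
    unfolding Mellin_Barnes_integral[OF assms, symmetric]
    by (subst gamma_product_duplication) (use assms in simp_all)
  then have lim: "residue_sum \<longlonglongrightarrow> of_real (sqrt pi) * of_real (I1 z \<nu>)"
    using residue_sum_limit[of 1] by (simp add: field_simps)
  \<comment> \<open>The parameter 0 alone contributes a pole at every \<open>-k\<close>.\<close>
  have unbounded: "\<exists>p\<in>gamma_poles ?B. Re p < b" for b
  proof -
    obtain k :: nat where "- b < real k" using reals_Archimedean2 by blast
    moreover have "- of_real (0 + real k) \<in> gamma_poles ?B"
      unfolding gamma_poles_def by (intro CollectI exI[of _ 0] exI[of _ k]) simp
    ultimately show ?thesis by (intro bexI[of _ "- of_real (0 + real k)"]) auto
  qed
  have loop_iff: "meijer_loop 3 0 [] [0, 1 / 2, 1 + of_real \<nu>] g \<longleftrightarrow>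
      valid_path g \<and> (\<forall>p\<in>gamma_poles ?B. loop_index g p 1)" for g
  proof -
    have "(\<forall>b\<in>set (take 3 [0, 1 / 2, 1 + complex_of_real \<nu>]). \<forall>w. is_pole (\<lambda>s. Gamma (b + s)) w \<longrightarrow> loop_index g w 1)
        \<longleftrightarrow> (\<forall>b\<in>set ?B. \<forall>w. is_pole (\<lambda>s. Gamma (of_real b + s)) w \<longrightarrow> loop_index g w 1)"
      by simp
    also have "\<dots> \<longleftrightarrow> (\<forall>p\<in>gamma_poles ?B. loop_index g p 1)"
      unfolding is_pole_Gamma_shift_iff gamma_poles_eq_UN[of ?B] by blast
    finally show ?thesis by (simp add: meijer_loop_def)
  qed
  have "meijer_loop 3 0 [] [0, 1 / 2, 1 + of_real \<nu>] (linepath (Complex 1 (- 1)) (Complex 1 1))"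
    unfolding loop_iff
  proof (intro conjI ballI loop_index_vertical_segment)
    fix p assume "p \<in> gamma_poles ?B"
    then show "Im p = 0" "Re p < 1" using P_real P_nonpos[of p] by auto
  qed simp
  then show ?thesis
    unfolding has_meijer_G_def meijer_integrand_eq_gamma_product
    using loop_integral_limit[OF _ _ unbounded lim] loop_iff assms
    by (intro conjI exI allI impI) auto
qed

text \<open>An admissible loop exists by definition, and both values are limits of the same
  truncated integrals along a proper filter.\<close>

lemma has_meijer_G_unique:
  assumes "has_meijer_G m n A B z v" "has_meijer_G m n A B z v'"
  shows "v = v'"
proof -
  obtain g where "meijer_loop m n A B g" using assms(1) unfolding has_meijer_G_def by blast
  then have "((\<lambda>(S, T). 1 / (2 * of_real pi * \<i>) *
      contour_integral (trunc_loop g S T) (meijer_integrand m n A B z)) \<longlongrightarrow> u)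
      (at_top \<times>\<^sub>F at_top)" if "u \<in> {v, v'}" for u
    using assms that unfolding has_meijer_G_def by blast
  from this[of v] this[of v'] show ?thesis
    by (intro tendsto_unique[of "at_top \<times>\<^sub>F at_top :: (real \<times> real) filter"])
       (simp_all add: prod_filter_eq_bot)
qed

theorem corollary4p2:
  fixes z \<nu> :: real
  assumes "z > 0" and "\<nu> \<ge> 0"
  shows "complex_of_real (I1 z \<nu>) =
    complex_of_real (pi powr (- 1 / 2)) *
    meijer_G 3 0 [] [0, 1 / 2, 1 + complex_of_real \<nu>] (complex_of_real (z\<^sup>2 / 4))"
proof -
  have "meijer_G 3 0 [] [0, 1 / 2, 1 + complex_of_real \<nu>] (complex_of_real (z\<^sup>2 / 4)) =
      of_real (sqrt pi) * of_real (I1 z \<nu>)"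
    unfolding meijer_G_def
    using has_meijer_G_Mellin_Barnes[OF assms] has_meijer_G_unique by (intro the_equality)
  moreover have "pi powr (- 1 / 2) * sqrt pi = 1"
    by (simp add: powr_half_sqrt[symmetric] powr_add[symmetric])
  then have "complex_of_real (pi powr (- 1 / 2)) * of_real (sqrt pi) = 1"
    by (metis of_real_1 of_real_mult)
  ultimately show ?thesis by (simp add: mult.assoc[symmetric])
qed

end
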